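(* A reseeded bracket is ordered if and only if it is the proper reseeded bracket whose signature can be generated by the following procedure: 1. Start with the list $[[0]]$. 2. As many times as desired (possibly zero), prepend to the list one of the lists $[[1]]$, $[[3;0]]$, or $[[3;2;0]]$. 3. Then add $1$ to the first element of the resulting list.
   Context: Teams $t_1,\dots,t_n$ are given in seed order; smaller numbers are higher seeds. A matchup table is a matrix $p_{ij}=\mathbb P[t_i\text{ beats }t_j]\in[0,1]$ with $p_{ij}+p_{ji}=1$ (so $p_{ii}=1/2$); game outcomes are independent. The list of teams is strongly stochastically transitive (SST) if $p_{ij}\le p_{ik}$ for all $i,j,k$ with $j<k$. A reseeded bracket with $r$ rounds on $n$ teams is specified by a number of byes $b(i)\in\{0,\dots,r\}$ for each seed $i$. In round $s=1,\dots,r$, the teams playing are the not-yet-defeated teams with $b(i)<s$ (the remaining undefeated teams have a bye); there are an even, positive number of them. They are paired by seed: the highest-seeded team playing that round plays the lowest-seeded team playing that round, the second-highest plays the second-lowest, and so on. A team that loses is eliminated. After round $r$ exactly one team is undefeated, and it is the champion. The signature is the list $[[a_0;\dots;a_r]]$ where $a_i$ is the number of teams with exactly $i$ byes. A tournament goes chalk if the higher-seeded team wins every game. A reseeded bracket is proper if, when it goes chalk, in every round, for all $i<j$ with $t_i,t_j$ not yet eliminated: if $t_j$ has a bye then so does $t_i$, and if both play then the opponent of $t_i$ has a larger seed number than the opponent of $t_j$. For every list that is the signature of some reseeded bracket there is exactly one proper reseeded bracket with that signature. An $n$-team tournament format is ordered if for every SST list of $n$ teams and all $i<j$, the probability that $t_i$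 is champion is at least the probability that $t_j$ is champion. "Prepend" means concatenating in front: for example prepending $[[3;2;0]]$ to $[[0]]$ gives $[[3;2;0;0]]$, and step 3 then gives $[[4;2;0;0]]$. *)

theory Defs
  imports "HOL-Probability.Product_PMF"
begin

text \<open>Teams are identified with their seeds \<open>1, \<dots>, n\<close>; a smaller number is a higher seed.\<close>

definition matchup_table :: "nat \<Rightarrow> (nat \<Rightarrow> nat \<Rightarrow> real) \<Rightarrow> bool" where
  "matchup_table n p \<longleftrightarrow>
     (\<forall>i\<in>{1..n}. \<forall>j\<in>{1..n}. 0 \<le> p i j \<and> p i j \<le> 1 \<and> p i j + p j i = 1)"

definition SST :: "nat \<Rightarrow> (nat \<Rightarrow> nat \<Rightarrow> real) \<Rightarrow> bool" where
  "SST n p \<longleftrightarrow> matchup_table n p \<and>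
     (\<forall>i\<in>{1..n}. \<forall>j\<in>{1..n}. \<forall>k\<in>{1..n}. j < k \<longrightarrow> p i j \<le> p i k)"

text \<open>A format is represented by its map from a matchup table and a team to the probability
  that this team is the champion.\<close>

definition ordered_format :: "nat \<Rightarrow> ((nat \<Rightarrow> nat \<Rightarrow> real) \<Rightarrow> nat \<Rightarrow> real) \<Rightarrow> bool" where
  "ordered_format n F \<longleftrightarrow>
     (\<forall>p. SST n p \<longrightarrow> (\<forall>i\<in>{1..n}. \<forall>j\<in>{1..n}. i < j \<longrightarrow> F p i \<ge> F p j))"

text \<open>Below, \<open>b\<close> gives the number of byes of each seed, \<open>s \<ge> 1\<close> is a round, and \<open>U\<close> is the set of
  teams undefeated at the start of that round.\<close>

definition playing :: "(nat \<Rightarrow> nat) \<Rightarrow> nat \<Rightarrow> nat set \<Rightarrow> nat set" where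
  "playing b s U = {i\<in>U. b i < s}"

text \<open>The higher seed is the first component of each game.\<close>

definition games :: "(nat \<Rightarrow> nat) \<Rightarrow> nat \<Rightarrow> nat set \<Rightarrow> (nat \<times> nat) set" where
  "games b s U =
     (let xs = sorted_list_of_set (playing b s U); m = length xs
      in {(xs ! k, xs ! (m - 1 - k)) | k. k < m div 2})"

text \<open>An outcome function \<open>w\<close> says of a game \<open>(i, j)\<close> whether \<open>i\<close>, the higher seed, wins it.\<close>

definition after_round ::
  "(nat \<Rightarrow> nat) \<Rightarrow> nat \<Rightarrow> (nat \<times> nat \<Rightarrow> bool) \<Rightarrow> nat set \<Rightarrow> nat set" where
  "after_round b s w U = U - (\<lambda>(i, j). if w (i, j) then j else i) ` games b s U"

text \<open>A single outcome function serves for all rounds, since the loser of a game is eliminated and so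
  two teams meet at most once.\<close>

fun undefeated :: "nat \<Rightarrow> (nat \<Rightarrow> nat) \<Rightarrow> (nat \<times> nat \<Rightarrow> bool) \<Rightarrow> nat \<Rightarrow> nat set" where
  "undefeated n b w 0 = {1..n}"
| "undefeated n b w (Suc s) = after_round b (Suc s) w (undefeated n b w s)"

definition reseeded_bracket :: "nat \<Rightarrow> nat \<Rightarrow> (nat \<Rightarrow> nat) \<Rightarrow> bool" where
  "reseeded_bracket n r b \<longleftrightarrow>
     (\<forall>i\<in>{1..n}. b i \<le> r) \<and>
     (\<forall>w. (\<forall>s\<in>{1..r}. let m = card (playing b s (undefeated n b w (s - 1)))
                      in even m \<and> m > 0) \<and>
          card (undefeated n b w r) = 1)"

definition signature :: "nat \<Rightarrow> nat \<Rightarrow> (nat \<Rightarrow> nat) \<Rightarrow> nat list" where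
  "signature n r b = map (\<lambda>k. card {i\<in>{1..n}. b i = k}) [0..<Suc r]"

definition round_pmf ::
  "(nat \<Rightarrow> nat \<Rightarrow> real) \<Rightarrow> (nat \<Rightarrow> nat) \<Rightarrow> nat \<Rightarrow> nat set \<Rightarrow> nat set pmf" where
  "round_pmf p b s U =
     map_pmf (\<lambda>w. after_round b s w U)
       (Pi_pmf (games b s U) False (\<lambda>(i, j). bernoulli_pmf (p i j)))"

fun undefeated_pmf ::
  "nat \<Rightarrow> (nat \<Rightarrow> nat) \<Rightarrow> (nat \<Rightarrow> nat \<Rightarrow> real) \<Rightarrow> nat \<Rightarrow> nat set pmf" where
  "undefeated_pmf n b p 0 = return_pmf {1..n}"
| "undefeated_pmf n b p (Suc s) = bind_pmf (undefeated_pmf n b p s) (round_pmf p b (Suc s))"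

definition champion_prob ::
  "nat \<Rightarrow> nat \<Rightarrow> (nat \<Rightarrow> nat) \<Rightarrow> (nat \<Rightarrow> nat \<Rightarrow> real) \<Rightarrow> nat \<Rightarrow> real" where
  "champion_prob n r b p i = pmf (undefeated_pmf n b p r) {i}"

definition meet :: "(nat \<Rightarrow> nat) \<Rightarrow> nat \<Rightarrow> nat set \<Rightarrow> nat \<Rightarrow> nat \<Rightarrow> bool" where
  "meet b s U i j \<longleftrightarrow> (i, j) \<in> games b s U \<or> (j, i) \<in> games b s U"

abbreviation chalk :: "nat \<times> nat \<Rightarrow> bool" where
  "chalk \<equiv> \<lambda>_. True"

definition proper :: "nat \<Rightarrow> nat \<Rightarrow> (nat \<Rightarrow> nat) \<Rightarrow> bool" where
  "proper n r b \<longleftrightarrow> reseeded_bracket n r b \<and>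
     (\<forall>s\<in>{1..r}. let U = undefeated n b chalk (s - 1) in
        \<forall>i\<in>U. \<forall>j\<in>U. i < j \<longrightarrow>
          (s \<le> b j \<longrightarrow> s \<le> b i) \<and>
          (\<forall>x y. meet b s U i x \<and> meet b s U j y \<longrightarrow> x > y))"

inductive prepended :: "nat list \<Rightarrow> bool" where
  "prepended [0]"
| "prepended xs \<Longrightarrow> prepended ([1] @ xs)"
| "prepended xs \<Longrightarrow> prepended ([3, 0] @ xs)"
| "prepended xs \<Longrightarrow> prepended ([3, 2, 0] @ xs)"

definition generated :: "nat list \<Rightarrow> bool" where
  "generated l \<longleftrightarrow> (\<exists>x xs. prepended (x # xs) \<and> l = (x + 1) # xs)"

end

theory Submission
  imports Defs
begin

text \<open>In a reseeded bracket the number of teams playing in a round does not depend on the results, and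
  a signature is generated exactly if these numbers are composed of the blocks \<open>2\<close>, \<open>4, 2\<close> and
  \<open>4, 4, 2\<close>. Such a block is a tournament among the two, four or six lowest seeds, whose winner becomes
  the lowest seed of the remaining tournament. The three small tournaments are ordered, replacing
  their lowest seed by a weaker team lowers its chances, and both properties are inherited by
  concatenation of blocks.

  Conversely, with fair coins a team wins with probability \<open>2\<close> to the power of minus its number of games,
  so in an ordered bracket the number of byes does not increase with the seed number, that is, the
  bracket is proper.
  If the numbers of players are not composed of the three blocks, then somewhere they contain
  \<open>6, 4, 2\<close>, \<open>8, 4, 2\<close>, \<open>4, 4, 4, 2\<close>, \<open>6, 4, 4, 2\<close> or \<open>8, 4, 4, 2\<close>, and a counterexample for such a block
  extends to the whole bracket: the teams below the block are certain to lose, and the teams above it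
  are all equally strong against it.\<close>

subsection \<open>Rounds on sorted lists of teams\<close>

text \<open>With probabilities \<open>p\<close> this is the expectation of \<open>f\<close> over the
  list left after the games. The ring is left open so that the same recursion also computes with
  integer weights, which are executable.\<close>

fun mean_over :: "(nat \<Rightarrow> nat \<Rightarrow> 'a::comm_ring_1) \<Rightarrow> (nat \<times> nat) list \<Rightarrow> nat list \<Rightarrow> (nat list \<Rightarrow> 'a) \<Rightarrow> 'a"
  where
  "mean_over p [] L f = f L"
| "mean_over p ((i, j) # gs) L f =
     p i j * mean_over p gs (removeAll j L) f + p j i * mean_over p gs (removeAll i L) f"

definition pairing :: "nat list \<Rightarrow> (nat \<times> nat) list" where
  "pairing ys = zip (take (length ys div 2) ys) (rev ys)"

definition last_of :: "nat \<Rightarrow> 'a list \<Rightarrow> 'a list" where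
  "last_of m xs = drop (length xs - m) xs"

text \<open>\<open>ms\<close> lists the numbers of teams playing in the successive rounds; the players of a round are
  always the lowest seeds among the undefeated teams \<open>xs\<close>.\<close>

primrec win :: "(nat \<Rightarrow> nat \<Rightarrow> 'a::comm_ring_1) \<Rightarrow> nat list \<Rightarrow> nat list \<Rightarrow> nat \<Rightarrow> 'a" where
  "win p [] xs i = (if xs = [i] then 1 else 0)"
| "win p (m # ms) xs i = mean_over p (pairing (last_of m xs)) xs (\<lambda>zs. win p ms zs i)"

text \<open>This pins down \<open>k\<close>: every game removes one team and one team is left, so
  \<open>k\<close> is one more than the number of games.\<close>

fun fits :: "nat list \<Rightarrow> nat \<Rightarrow> bool" where
  "fits [] k \<longleftrightarrow> k = 1"
| "fits (m # ms) k \<longleftrightarrow> even m \<and> 0 < m \<and> m \<le> k \<and> fits ms (k - m div 2)"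

abbreviation teams_of :: "(nat \<times> nat) list \<Rightarrow> nat list" where
  "teams_of gs \<equiv> map fst gs @ map snd gs"

section \<open>Pairings and sublists of lowest seeds\<close>

lemma map_fst_pairing: "map fst (pairing ys) = take (length ys div 2) ys"
  by (simp add: pairing_def map_fst_zip_take)

lemma map_snd_pairing: "map snd (pairing ys) = take (length ys div 2) (rev ys)"
  by (simp add: pairing_def map_snd_zip_take)

lemma length_pairing: "length (pairing ys) = length ys div 2"
  by (simp add: pairing_def)

lemma even_half: "even m \<Longrightarrow> m - m div 2 = m div (2::nat)"
  by auto

lemma map_snd_pairing_even:
  "even (length ys) \<Longrightarrow> map snd (pairing ys) = rev (drop (length ys div 2) ys)"
  unfolding map_snd_pairing take_rev by (simp add: even_half)

lemma set_teams_pairing: "even (length ys) \<Longrightarrow> set (teams_of (pairing ys)) = set ys"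
  unfolding map_fst_pairing map_snd_pairing_even set_append set_rev
  by (metis append_take_drop_id set_append)

lemma distinct_teams_pairing:
  assumes "even (length ys)" "distinct ys" shows "distinct (teams_of (pairing ys))"
proof -
  have "distinct (take (length ys div 2) ys @ drop (length ys div 2) ys)" using assms by simp
  thus ?thesis using assms(1) unfolding map_fst_pairing map_snd_pairing_even[OF assms(1)]
    by (simp del: append_take_drop_id)
qed

lemma pairing_less:
  assumes "even (length ys)" "sorted_wrt (<) ys" "(x, y) \<in> set (pairing ys)"
  shows "x < y"
proof -
  have "x \<in> set (take (length ys div 2) ys)" "y \<in> set (drop (length ys div 2) ys)"
    using assms(3) map_fst_pairing[of ys] map_snd_pairing_even[OF assms(1)]
    by (metis fst_conv image_eqI list.set_map, metis snd_conv image_eqI list.set_map set_rev)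
  moreover have "sorted_wrt (<) (take (length ys div 2) ys @ drop (length ys div 2) ys)"
    using assms(2) by simp
  ultimately show ?thesis unfolding sorted_wrt_append by blast
qed

lemma pairing_mem: "(x, y) \<in> set (pairing ys) \<Longrightarrow> x \<in> set ys \<and> y \<in> set ys"
  by (metis in_set_takeD pairing_def set_rev set_zip_leftD set_zip_rightD)

lemma set_last_of: "set (last_of m xs) \<subseteq> set xs"
  by (simp add: last_of_def set_drop_subset)

lemma length_last_of: "m \<le> length xs \<Longrightarrow> length (last_of m xs) = m"
  by (simp add: last_of_def)

lemma sorted_last_of: "sorted_wrt (<) xs \<Longrightarrow> sorted_wrt (<) (last_of m xs)"
  by (simp add: last_of_def sorted_wrt_drop)

lemma last_of_append: "m \<le> length ys \<Longrightarrow> last_of m (xs @ ys) = last_of m ys"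
  by (simp add: last_of_def)

lemma sorted_distinct: "sorted_wrt (<) (xs :: nat list) \<Longrightarrow> distinct xs"
  by (simp add: strict_sorted_iff)

text \<open>An invariant of the recursion in \<open>mean_over\<close>: no team occurs in two games,
  so striking the loser of the first game leaves the others playable.\<close>

definition admissible :: "(nat \<times> nat) list \<Rightarrow> nat list \<Rightarrow> bool" where
  "admissible gs L \<longleftrightarrow>
     sorted_wrt (<) L \<and> distinct (teams_of gs) \<and> set (teams_of gs) \<subseteq> set L"

lemma admissible_pairing:
  assumes "sorted_wrt (<) xs" "even m" "m \<le> length xs"
  shows "admissible (pairing (last_of m xs)) xs"
  using assms distinct_teams_pairing[of "last_of m xs"] set_teams_pairing[of "last_of m xs"]
    length_last_of[OF assms(3)] set_last_of[of m xs] sorted_last_of[OF assms(1), of m]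
  by (auto simp: admissible_def sorted_distinct)

lemma length_pairing_last_of:
  "m \<le> length xs \<Longrightarrow> length (pairing (last_of m xs)) = m div 2"
  by (simp add: length_pairing length_last_of)

lemma admissible_Cons:
  assumes "admissible ((i, j) # gs) L"
  shows "admissible gs (removeAll j L)" "admissible gs (removeAll i L)"
    "length (removeAll j L) = length L - 1" "length (removeAll i L) = length L - 1"
    "i \<in> set L" "j \<in> set L" "i \<noteq> j" "0 < length L"
proof -
  have *: "distinct L" using assms by (simp add: admissible_def sorted_distinct)
  show "admissible gs (removeAll j L)" "admissible gs (removeAll i L)"
    using assms by (auto simp: admissible_def removeAll_filter_not_eq sorted_wrt_filter)
  show "i \<in> set L" "j \<in> set L" "i \<noteq> j" using assms by (auto simp: admissible_def)
  with * show "length (removeAll j L) = length L - 1" "length (removeAll i L) = length L - 1"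
    by (metis distinct_remove1_removeAll length_remove1)+
  show "0 < length L" using \<open>i \<in> set L\<close> by auto
qed

text \<open>A superset of the lists that can result from the games. It records little more than how
  many teams are left and that teams without a game stay, which is what the inductions over rounds
  use.\<close>

definition survivors :: "(nat \<times> nat) list \<Rightarrow> nat list \<Rightarrow> nat list set" where
  "survivors gs L = {zs. sorted_wrt (<) zs \<and> set zs \<subseteq> set L \<and>
     length zs + length gs = length L \<and> set L - set (teams_of gs) \<subseteq> set zs}"

lemma length_survivors:
  "zs \<in> survivors (pairing (last_of m xs)) xs \<Longrightarrow> m \<le> length xs \<Longrightarrow> length zs = length xs - m div 2"
  using length_pairing_last_of[of m xs] by (simp add: survivors_def) linarith

lemma survivors_Cons:
  assumes "admissible ((i, j) # gs) L"
  shows "survivors gs (removeAll j L) \<subseteq> survivors ((i, j) # gs) L"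
    "survivors gs (removeAll i L) \<subseteq> survivors ((i, j) # gs) L"
  using admissible_Cons[OF assms] by (auto simp: survivors_def)

section \<open>Expectations over the results of one round\<close>

lemma mean_over_cong:
  assumes "admissible gs L" "\<And>zs. zs \<in> survivors gs L \<Longrightarrow> f zs = g zs"
  shows "mean_over p gs L f = mean_over p gs L g"
  using assms
proof (induction gs arbitrary: L)
  case Nil
  then show ?case by (simp add: admissible_def survivors_def)
next
  case (Cons a gs)
  obtain i j where a: "a = (i, j)" by force
  note ad = Cons.prems(1)[unfolded a]
  have "mean_over p gs (removeAll j L) f = mean_over p gs (removeAll j L) g"
    by (rule Cons.IH[OF admissible_Cons(1)[OF ad]])
      (use Cons.prems(2) survivors_Cons[OF ad] a in auto)
  moreover have "mean_over p gs (removeAll i L) f = mean_over p gs (removeAll i L) g"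
    by (rule Cons.IH[OF admissible_Cons(2)[OF ad]])
      (use Cons.prems(2) survivors_Cons[OF ad] a in auto)
  ultimately show ?case by (simp add: a)
qed

lemma mean_over_nonneg:
  fixes p :: "nat \<Rightarrow> nat \<Rightarrow> real"
  assumes "\<And>x y. x \<in> A \<Longrightarrow> y \<in> A \<Longrightarrow> 0 \<le> p x y" "set (teams_of gs) \<subseteq> A"
    "\<And>zs. set zs \<subseteq> set L \<Longrightarrow> 0 \<le> f zs"
  shows "0 \<le> mean_over p gs L f"
  using assms(2,3)
proof (induction gs arbitrary: L)
  case (Cons a gs)
  obtain i j where a: "a = (i, j)" by force
  have "0 \<le> mean_over p gs (removeAll j L) f" "0 \<le> mean_over p gs (removeAll i L) f"
    by (rule Cons.IH; use Cons.prems in \<open>auto simp: subset_eq\<close>)+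
  moreover have "0 \<le> p i j" "0 \<le> p j i" using assms(1) Cons.prems(1) a by auto
  ultimately show ?case by (simp add: a)
qed auto

lemma mean_over_sum:
  "mean_over p gs L (\<lambda>z. \<Sum>x\<in>A. f x z * c x) = (\<Sum>x\<in>A. mean_over p gs L (f x) * c x)"
proof (induction gs arbitrary: L)
  case (Cons a gs)
  obtain i j where a: "a = (i, j)" by force
  show ?case
    by (simp add: a Cons.IH sum_distrib_left sum.distrib distrib_right mult.assoc)
qed auto

lemma mean_over_append:
  assumes "set (teams_of gs) \<inter> set T = {}"
  shows "mean_over p gs (T @ B) f = mean_over p gs B (\<lambda>z. f (T @ z))"
  using assms
proof (induction gs arbitrary: B)
  case (Cons a gs)
  obtain i j where a: "a = (i, j)" by force
  have "removeAll i T = T" "removeAll j T = T" using Cons.prems a by auto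
  then show ?case using Cons by (simp add: a)
qed auto

text \<open>The team \<open>i\<close> plays at most one game and wins it with probability
  \<open>q\<close>; all other games sum out to 1. Applied to fair coins and to the weakest team of a
  list.\<close>

lemma mean_over_indicator:
  assumes "admissible gs L"
    "\<And>x y. (x, y) \<in> set gs \<Longrightarrow> p x y + p y x = 1 \<and> (x = i \<longrightarrow> p x y = q) \<and> (y = i \<longrightarrow> p y x = q)"
  shows "mean_over p gs L (\<lambda>zs. if i \<in> set zs then c else 0) =
    (if i \<in> set L then if i \<in> set (teams_of gs) then q * c else c else 0)"
  using assms
proof (induction gs arbitrary: L)
  case (Cons a gs)
  obtain x y where a: "a = (x, y)" by force
  note ad = Cons.prems(1)[unfolded a]
  note ac = admissible_Cons[OF ad]
  have p: "p x y + p y x = 1" "x = i \<longrightarrow> p x y = q" "y = i \<longrightarrow> p y x = q"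
    using Cons.prems(2)[of x y] a by auto
  have p': "p x y * c + p y x * c = c" for c using p(1) by (metis distrib_right mult_1)
  have nin: "x \<notin> set (teams_of gs)" "y \<notin> set (teams_of gs)"
    using ad by (auto simp: admissible_def)
  have L: "x \<in> set L" "y \<in> set L" "x \<noteq> y" using ac by auto
  have E1: "mean_over p gs (removeAll y L) (\<lambda>zs. if i \<in> set zs then c else 0) =
     (if i \<in> set (removeAll y L) then if i \<in> set (teams_of gs) then q * c else c else 0)"
    by (rule Cons.IH[OF ac(1)]) (use Cons.prems(2) in auto)
  have E2: "mean_over p gs (removeAll x L) (\<lambda>zs. if i \<in> set zs then c else 0) =
     (if i \<in> set (removeAll x L) then if i \<in> set (teams_of gs) then q * c else c else 0)"
    by (rule Cons.IH[OF ac(2)]) (use Cons.prems(2) in auto)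
  consider "i = x" | "i = y" | "i \<noteq> x" "i \<noteq> y" by blast
  then show ?case
  proof cases
    case 1
    then show ?thesis unfolding a mean_over.simps E1 E2 using nin L p by simp
  next
    case 2
    then show ?thesis unfolding a mean_over.simps E1 E2 using nin L p by simp
  next
    case 3
    then have s: "i \<in> set (removeAll x L) \<longleftrightarrow> i \<in> set L" "i \<in> set (removeAll y L) \<longleftrightarrow> i \<in> set L"
      "i \<in> set (teams_of (a # gs)) \<longleftrightarrow> i \<in> set (teams_of gs)"
      using a by auto
    show ?thesis unfolding a mean_over.simps E1 E2 s[unfolded a] by (rule p')
  qed
qed auto

lemma mean_over_chalk:
  assumes "\<And>x y. (x, y) \<in> set gs \<Longrightarrow> p x y = 1 \<and> p y x = 0"
  shows "mean_over p gs L f = f (filter (\<lambda>x. x \<notin> snd ` set gs) L)"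
  using assms
proof (induction gs arbitrary: L)
  case (Cons a gs)
  obtain i j where a: "a = (i, j)" by force
  have "p i j = 1" "p j i = 0" using Cons.prems a by auto
  moreover have "filter (\<lambda>x. x \<notin> snd ` set gs) (removeAll j L) = filter (\<lambda>x. x \<notin> snd ` set (a # gs)) L"
    by (auto simp: a removeAll_filter_not_eq intro: filter_cong)
  ultimately show ?case using Cons by (simp add: a)
qed auto

section \<open>Winning probabilities over several rounds\<close>

lemma win_eq_0: "i \<notin> set xs \<Longrightarrow> win p ms xs i = 0"
proof (induction ms arbitrary: xs)
  case (Cons m ms)
  have "mean_over p gs L (\<lambda>zs. win p ms zs i) = 0" if "i \<notin> set L" for gs L
    using that
  proof (induction gs arbitrary: L)
    case (Cons a gs)
    obtain x y where "a = (x, y)" by force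
    then show ?case using Cons by simp
  qed (simp add: Cons.IH)
  then show ?case using Cons by simp
qed auto

lemma win_nonneg:
  fixes p :: "nat \<Rightarrow> nat \<Rightarrow> real"
  assumes "\<And>x y. x \<in> A \<Longrightarrow> y \<in> A \<Longrightarrow> 0 \<le> p x y" "set xs \<subseteq> A" "fits ms (length xs)"
    "sorted_wrt (<) xs"
  shows "0 \<le> win p ms xs i"
  using assms(2-)
proof (induction ms arbitrary: xs)
  case (Cons m ms)
  then have m: "even m" "m \<le> length xs" by auto
  let ?gs = "pairing (last_of m xs)"
  have ad: "admissible ?gs xs" using admissible_pairing m Cons.prems by blast
  \<comment> \<open>Setting the value to 0 off \<open>survivors\<close> makes it nonnegative on
    every list of teams, as \<open>mean_over_nonneg\<close> requires; the induction hypothesis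
    covers only lists of the right length.\<close>
  define f where "f = (\<lambda>zs. if zs \<in> survivors ?gs xs then win p ms zs i else 0)"
  have "win p (m # ms) xs i = mean_over p ?gs xs f"
    unfolding win.simps by (rule mean_over_cong[OF ad]) (simp add: f_def)
  also have "\<dots> \<ge> 0"
  proof (rule mean_over_nonneg[OF assms(1)])
    show "set (teams_of ?gs) \<subseteq> A"
      using ad Cons.prems(1) by (auto simp: admissible_def)
    show "0 \<le> f zs" if "set zs \<subseteq> set xs" for zs
    proof (cases "zs \<in> survivors ?gs xs")
      case True
      then have "length zs = length xs - m div 2"
        using length_survivors m(2) by blast
      then show ?thesis using True Cons.IH[of zs] Cons.prems that by (auto simp: f_def survivors_def)
    qed (simp add: f_def)
  qed
  finally show ?case .
qed auto

text \<open>The block \<open>g\<close> reduces its \<open>k\<close> bottom teams to one, so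
  \<open>n - k + 1\<close> teams enter the rounds \<open>ms\<close>.\<close>

lemma fits_append:
  "fits (g @ ms) n \<Longrightarrow> fits g k \<Longrightarrow> k \<le> n \<and> fits ms (n - k + 1)"
proof (induction g arbitrary: n k)
  case Nil
  have "1 \<le> n" using Nil(1) by (cases ms) auto
  then show ?case using Nil by simp
next
  case (Cons m g)
  have "k - m div 2 \<le> n - m div 2 \<and> fits ms (n - m div 2 - (k - m div 2) + 1)"
    by (rule Cons.IH) (use Cons.prems in auto)
  moreover have "m div 2 \<le> k" "m \<le> n" using Cons.prems by auto
  moreover from this have "n - m div 2 - (k - m div 2) = n - k" "k - m div 2 \<le> n - m div 2 \<longleftrightarrow> k \<le> n"
    by linarith+
  ultimately show ?case by simp
qed

text \<open>A block of rounds that is played out among the bottom teams \<open>B\<close> delivers one of them as the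
  new bottom team.\<close>

lemma win_append:
  assumes "sorted_wrt (<) (T @ B)" "fits g (length B)"
  shows "win p (g @ ms) (T @ B) i = (\<Sum>x\<in>set B. win p g B x * win p ms (T @ [x]) i)"
  using assms
proof (induction g arbitrary: B)
  case Nil
  then obtain x where "B = [x]" by (auto simp: length_Suc_conv)
  then show ?case by simp
next
  case (Cons m g)
  have m: "even m" "m \<le> length B" "fits g (length B - m div 2)" using Cons.prems by auto
  let ?gs = "pairing (last_of m B)"
  have sB: "sorted_wrt (<) B" using Cons.prems by (simp add: sorted_wrt_append)
  have ad: "admissible ?gs B" using admissible_pairing m sB by blast
  have disj: "set (teams_of ?gs) \<inter> set T = {}"
    using ad sorted_distinct[OF Cons.prems(1)] by (auto simp: admissible_def)
  have "win p ((m # g) @ ms) (T @ B) i = mean_over p ?gs B (\<lambda>zs. win p (g @ ms) (T @ zs) i)"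
    using m disj by (simp add: last_of_append mean_over_append)
  also have "\<dots> = mean_over p ?gs B (\<lambda>zs. \<Sum>x\<in>set B. win p g zs x * win p ms (T @ [x]) i)"
  proof (rule mean_over_cong[OF ad])
    fix zs assume zs: "zs \<in> survivors ?gs B"
    have "win p (g @ ms) (T @ zs) i = (\<Sum>x\<in>set zs. win p g zs x * win p ms (T @ [x]) i)"
    proof (rule Cons.IH)
      show "sorted_wrt (<) (T @ zs)"
        using zs Cons.prems(1) by (auto simp: survivors_def sorted_wrt_append)
      have "length zs = length B - m div 2"
        using length_survivors m(2) zs by blast
      then show "fits g (length zs)" using m by simp
    qed
    also have "\<dots> = (\<Sum>x\<in>set B. win p g zs x * win p ms (T @ [x]) i)"
      by (rule sum.mono_neutral_left) (use zs in \<open>auto simp: survivors_def win_eq_0\<close>)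
    finally show "win p (g @ ms) (T @ zs) i = (\<Sum>x\<in>set B. win p g zs x * win p ms (T @ [x]) i)" .
  qed
  finally show ?case by (simp add: mean_over_sum)
qed

text \<open>A team of the bottom block stays in only by winning that block, so a single summand of
  \<open>win_append\<close> is nonzero.\<close>

lemma win_append_bottom:
  assumes "sorted_wrt (<) (T @ B)" "fits g (length B)" "i \<in> set B"
  shows "win p (g @ ms) (T @ B) i = win p g B i * win p ms (T @ [i]) i"
proof -
  have "win p ms (T @ [x]) i = 0" if "x \<in> set B" "x \<noteq> i" for x
    using sorted_distinct[OF assms(1)] that assms(3) by (intro win_eq_0) auto
  then have "(\<Sum>x\<in>set B. win p g B x * win p ms (T @ [x]) i) =
      (\<Sum>x\<in>{i}. win p g B x * win p ms (T @ [x]) i)"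
    using assms(3) by (intro sum.mono_neutral_right) auto
  then show ?thesis using win_append[OF assms(1,2), of p ms i] by simp
qed

subsection \<open>From the bracket to sorted lists\<close>

text \<open>Peels off the first of the remaining rounds, whereas \<open>undefeated_pmf\<close> peels
  off the last. This matches the recursion of \<open>win\<close> and permits induction on the number
  of rounds left.\<close>

primrec later ::
  "(nat \<Rightarrow> nat \<Rightarrow> real) \<Rightarrow> (nat \<Rightarrow> nat) \<Rightarrow> nat \<Rightarrow> nat \<Rightarrow> nat set \<Rightarrow> nat set pmf" where
  "later p b 0 s U = return_pmf U"
| "later p b (Suc k) s U = bind_pmf (round_pmf p b (Suc s) U) (later p b k (Suc s))"

lemma undefeated_pmf_add:
  "undefeated_pmf n b p (s + k) = bind_pmf (undefeated_pmf n b p s) (later p b k s)"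
proof (induction k arbitrary: s)
  case 0
  have "later p b 0 s = return_pmf" by auto
  then show ?case by (simp add: bind_return_pmf')
next
  case (Suc k)
  have "later p b (Suc k) s = (\<lambda>U. bind_pmf (round_pmf p b (Suc s) U) (later p b k (Suc s)))" by auto
  then show ?case using Suc[of "Suc s"] by (simp add: bind_assoc_pmf)
qed

lemma champion_prob_later: "champion_prob n r b p i = pmf (later p b r 0 {1..n}) {i}"
  using undefeated_pmf_add[of n b p 0 r] by (simp add: champion_prob_def bind_return_pmf)

lemma games_eq_pairing: "games b s U = set (pairing (sorted_list_of_set (playing b s U)))"
proof -
  define ys where "ys = sorted_list_of_set (playing b s U)"
  have "set (pairing ys) = {(ys ! k, rev ys ! k) |k. k < length ys div 2}"
    by (auto simp: pairing_def set_zip) (metis nth_take)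
  also have "\<dots> = {(ys ! k, ys ! (length ys - 1 - k)) |k. k < length ys div 2}"
    by (auto simp: rev_nth)
  finally show ?thesis by (simp add: games_def Let_def ys_def)
qed

lemma pmf_bind_bernoulli:
  assumes "0 \<le> q" "q \<le> 1"
  shows "pmf (bind_pmf (bernoulli_pmf q) f) S = q * pmf (f True) S + (1 - q) * pmf (f False) S"
  using assms by (simp add: pmf_bind)

text \<open>The games of a round are independent, so their coins can be drawn one at a time; each
  draw deletes one loser, as in \<open>mean_over\<close>. The continuation \<open>K\<close> stands
  for the later rounds.\<close>

lemma pmf_bind_outcomes:
  fixes p :: "nat \<Rightarrow> nat \<Rightarrow> real"
  assumes "distinct gs"
    "\<And>x y. (x, y) \<in> set gs \<Longrightarrow> 0 \<le> p x y \<and> p x y \<le> 1 \<and> p x y + p y x = 1"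
  shows "pmf (bind_pmf (Pi_pmf (set gs) False (\<lambda>(i, j). bernoulli_pmf (p i j)))
      (\<lambda>w. K (set L - (\<lambda>(i, j). if w (i, j) then j else i) ` set gs))) S
    = mean_over p gs L (\<lambda>zs. pmf (K (set zs)) S)"
  using assms
proof (induction gs arbitrary: L)
  case Nil
  then show ?case by (simp add: bind_return_pmf)
next
  case (Cons a gs)
  obtain i j where a: "a = (i, j)" by force
  let ?P = "Pi_pmf (set gs) False (\<lambda>(i, j). bernoulli_pmf (p i j))"
  let ?R = "\<lambda>w. (\<lambda>(i, j). if w (i, j) then j else i)"
  have nin: "(i, j) \<notin> set gs" using Cons.prems a by auto
  have p: "0 \<le> p i j" "p i j \<le> 1" "p j i = 1 - p i j" using Cons.prems(2)[of i j] a by auto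
  \<comment> \<open>Fixing the result of \<open>(i, j)\<close> does not affect the losers of the
    other games.\<close>
  have R: "?R (f((i, j) := y)) ` insert (i, j) (set gs) = insert (if y then j else i) (?R f ` set gs)"
    for f y
  proof -
    have "?R (f((i, j) := y)) ` set gs = ?R f ` set gs"
      by (rule image_cong) (use nin in auto)
    then show ?thesis by simp
  qed
  have D: "set L - insert (if y then j else i) X = set (removeAll (if y then j else i) L) - X" for y X
    by auto
  have IH: "pmf (bind_pmf ?P (\<lambda>w. K (set L' - ?R w ` set gs))) S
    = mean_over p gs L' (\<lambda>zs. pmf (K (set zs)) S)" for L'
    by (rule Cons.IH) (use Cons.prems in auto)
  have "bind_pmf (Pi_pmf (set (a # gs)) False (\<lambda>(i, j). bernoulli_pmf (p i j)))
      (\<lambda>w. K (set L - ?R w ` set (a # gs)))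
    = bind_pmf (bernoulli_pmf (p i j)) (\<lambda>y. bind_pmf ?P
        (\<lambda>f. K (set (removeAll (if y then j else i) L) - ?R f ` set gs)))"
    unfolding a list.set Pi_pmf_insert'[OF finite_set nin]
    by (simp only: bind_assoc_pmf bind_return_pmf R D prod.case)
  then show ?case unfolding a using p IH[of "removeAll i L"] IH[of "removeAll j L"] by (simp add: pmf_bind_bernoulli)
qed

lemma sorted_list_of_set_filter:
  "sorted_wrt (<) xs \<Longrightarrow> sorted_list_of_set {i \<in> set xs. P i} = filter P (xs :: nat list)"
  by (metis set_filter sorted_list_of_set.idem_if_sorted_distinct sorted_wrt_filter strict_sorted_iff)

lemma sorted_playing:
  "sorted_wrt (<) xs \<Longrightarrow>
    sorted_list_of_set (playing b s (set xs)) = filter (\<lambda>i. b i < s) xs"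
  by (simp add: playing_def sorted_list_of_set_filter)

lemma later_Suc:
  assumes p: "matchup_table n p" and xs: "sorted_wrt (<) xs" "set xs \<subseteq> {1..n}"
    and ev: "even (length (filter (\<lambda>i. b i < Suc s) xs))"
  shows "pmf (later p b (Suc k) s (set xs)) S =
    mean_over p (pairing (filter (\<lambda>i. b i < Suc s) xs)) xs (\<lambda>zs. pmf (later p b k (Suc s) (set zs)) S)"
proof -
  let ?gs = "pairing (filter (\<lambda>i. b i < Suc s) xs)"
  have g: "games b (Suc s) (set xs) = set ?gs"
    by (simp add: games_eq_pairing sorted_playing[OF xs(1)])
  have "distinct (teams_of ?gs)" "set (teams_of ?gs) \<subseteq> {1..n}"
    using distinct_teams_pairing[OF ev] set_teams_pairing[OF ev] sorted_distinct[OF xs(1)] xs(2)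
    by auto
  then have d: "distinct ?gs" and "fst ` set ?gs \<subseteq> {1..n}" "snd ` set ?gs \<subseteq> {1..n}"
    by (auto simp: distinct_map)
  then have m: "x \<in> {1..n} \<and> y \<in> {1..n}" if "(x, y) \<in> set ?gs" for x y
    using that by (metis fst_conv snd_conv image_eqI subsetD)
  have "0 \<le> p x y \<and> p x y \<le> 1 \<and> p x y + p y x = 1" if "(x, y) \<in> set ?gs" for x y
    using m[OF that] p by (auto simp: matchup_table_def)
  note * = pmf_bind_outcomes[of ?gs p "later p b k (Suc s)" xs S, OF d this]
  show ?thesis
    unfolding later.simps round_pmf_def bind_map_pmf after_round_def g using * by simp
qed

section \<open>Round sizes of a bracket and their independence of the results\<close>

locale bracket =
  fixes n r :: nat and b :: "nat \<Rightarrow> nat"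
  assumes bracket: "reseeded_bracket n r b"
begin

text \<open>The chalk results serve as a reference run; \<open>reachable_survivors\<close> shows
  that every other run has the same counts.\<close>

definition alive :: "nat \<Rightarrow> nat" where
  "alive s = card (undefeated n b chalk s)"

definition size_of :: "nat \<Rightarrow> nat" where
  "size_of s = card (playing b (Suc s) (undefeated n b chalk s))"

definition waiting :: "nat \<Rightarrow> nat" where
  "waiting s = card {i \<in> {1..n}. s \<le> b i}"

lemma byes_le: "i \<in> {1..n} \<Longrightarrow> b i \<le> r"
  using bracket by (simp add: reseeded_bracket_def)

lemma size_of_pos: "s < r \<Longrightarrow> even (size_of s) \<and> 0 < size_of s"
  using bracket unfolding reseeded_bracket_def size_of_def Let_def
  by (elim conjE allE[of _ chalk] ballE[of _ _ "Suc s"]) auto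

lemma alive_r: "alive r = 1"
  using bracket by (auto simp: reseeded_bracket_def alive_def)

lemma alive_0: "alive 0 = n"
  by (simp add: alive_def)

lemma undefeated_subset: "undefeated n b w s \<subseteq> {1..n}"
  by (induction s) (auto simp: after_round_def)

lemma finite_undefeated: "finite (undefeated n b w s)"
  using undefeated_subset finite_subset by blast

lemma games_subset_playing:
  assumes "finite U" shows "games b s U \<subseteq> playing b s U \<times> playing b s U"
proof -
  have f: "finite (playing b s U)" using assms by (simp add: playing_def)
  have "x \<in> playing b s U \<and> y \<in> playing b s U" if "(x, y) \<in> games b s U" for x y
    using pairing_mem[OF that[unfolded games_eq_pairing]] f by simp
  then show ?thesis by auto
qed

text \<open>A team with at least \<open>s\<close> byes sits out the first \<open>s\<close> rounds
  and cannot have lost.\<close>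

lemma waiting_undefeated: "{i \<in> {1..n}. s \<le> b i} \<subseteq> undefeated n b w s"
proof (induction s)
  case (Suc s)
  have "{i \<in> {1..n}. Suc s \<le> b i} \<inter> playing b (Suc s) (undefeated n b w s) = {}"
    by (auto simp: playing_def)
  then show ?case
    using Suc games_subset_playing[OF finite_undefeated, of "Suc s" w s]
    by (fastforce simp: after_round_def split: if_splits)
qed auto

text \<open>By \<open>waiting_undefeated\<close>, the undefeated teams without a game in round
  \<open>s + 1\<close> are exactly those with more than \<open>s\<close> byes.\<close>

lemma size_of_eq: "alive s = size_of s + waiting (Suc s)"
proof -
  let ?U = "undefeated n b chalk s"
  have "{i \<in> {1..n}. Suc s \<le> b i} \<subseteq> {i \<in> {1..n}. s \<le> b i}" by auto
  then have "?U = playing b (Suc s) ?U \<union> {i \<in> {1..n}. Suc s \<le> b i}"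
    using undefeated_subset[of chalk s] waiting_undefeated[of s chalk]
    by (auto simp: playing_def not_less)
  moreover have "card (playing b (Suc s) ?U \<union> {i \<in> {1..n}. Suc s \<le> b i}) =
      card (playing b (Suc s) ?U) + card {i \<in> {1..n}. Suc s \<le> b i}"
    by (rule card_Un_disjoint) (auto simp: playing_def finite_undefeated)
  ultimately show ?thesis by (simp add: alive_def size_of_def waiting_def)
qed

lemma alive_Suc:
  assumes "s < r" shows "alive (Suc s) = alive s - size_of s div 2"
proof -
  let ?U = "undefeated n b chalk s"
  let ?ys = "sorted_list_of_set (playing b (Suc s) ?U)"
  have f: "finite (playing b (Suc s) ?U)" by (simp add: playing_def finite_undefeated)
  have len: "length ?ys = size_of s" by (simp add: size_of_def)
  have "even (length ?ys)" using size_of_pos[OF assms] len by simp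
  from distinct_teams_pairing[OF this] have d: "distinct (map snd (pairing ?ys))" by simp
  have "snd ` games b (Suc s) ?U \<subseteq> ?U"
    using games_subset_playing[OF finite_undefeated, of "Suc s" chalk s] by (auto simp: playing_def)
  moreover have "card (snd ` games b (Suc s) ?U) = size_of s div 2"
    using distinct_card[OF d] len by (simp add: games_eq_pairing length_pairing)
  moreover have "(\<lambda>(i, j). j) = (snd :: nat \<times> nat \<Rightarrow> nat)" by auto
  ultimately show ?thesis
    by (simp add: alive_def after_round_def card_Diff_subset finite_subset[OF _ finite_undefeated])
qed

text \<open>Holds of the undefeated teams after round \<open>s\<close>, whatever the outcomes were.\<close>

definition reachable :: "nat \<Rightarrow> nat list \<Rightarrow> bool" where
  "reachable s xs \<longleftrightarrow> sorted_wrt (<) xs \<and> set xs \<subseteq> {1..n} \<and>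
     {i \<in> {1..n}. s \<le> b i} \<subseteq> set xs \<and> length xs = alive s"

lemma reachable_0: "reachable 0 [1..<Suc n]"
  by (auto simp: reachable_def alive_0 sorted_wrt_upt simp del: upt_Suc)

text \<open>The teams that sit out are fixed by \<open>b\<close> alone, and the number of undefeated
  teams is \<open>alive s\<close>; so the number of players cannot depend on earlier
  results.\<close>

lemma reachable_length_players:
  assumes "reachable s xs" shows "length (filter (\<lambda>i. b i < Suc s) xs) = size_of s"
proof -
  have d: "distinct xs" using assms sorted_distinct by (auto simp: reachable_def)
  have "{i \<in> set xs. \<not> b i < Suc s} = {i \<in> {1..n}. Suc s \<le> b i}"
    using assms by (auto simp: reachable_def)
  then have "length (filter (\<lambda>i. \<not> b i < Suc s) xs) = waiting (Suc s)"
    using distinct_card[OF distinct_filter[OF d]] unfolding waiting_def by (metis set_filter)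
  then show ?thesis
    using assms size_of_eq[of s] sum_length_filter_compl[of "\<lambda>i. b i < Suc s" xs]
    by (simp add: reachable_def)
qed

lemma reachable_admissible:
  assumes "reachable s xs" "s < r"
  shows "admissible (pairing (filter (\<lambda>i. b i < Suc s) xs)) xs"
proof -
  have "even (length (filter (\<lambda>i. b i < Suc s) xs))"
    using reachable_length_players size_of_pos assms by simp
  from distinct_teams_pairing[OF this] set_teams_pairing[OF this] show ?thesis
    using assms sorted_distinct[of xs] unfolding admissible_def reachable_def
    by auto
qed

lemma reachable_survivors:
  assumes "reachable s xs" "s < r" "zs \<in> survivors (pairing (filter (\<lambda>i. b i < Suc s) xs)) xs"
  shows "reachable (Suc s) zs"
proof -
  let ?ys = "filter (\<lambda>i. b i < Suc s) xs"
  have len: "length ?ys = size_of s" and ev: "even (length ?ys)"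
    using reachable_length_players size_of_pos assms by simp_all
  have "length zs + size_of s div 2 = alive s"
    using assms(1,3) by (simp add: survivors_def reachable_def length_pairing len)
  then have "length zs = alive (Suc s)" using alive_Suc[OF assms(2)] by simp
  moreover have "set xs - set ?ys \<subseteq> set zs"
    using assms(3) set_teams_pairing[OF ev] by (simp add: survivors_def)
  moreover have "{i \<in> {1..n}. Suc s \<le> b i} \<subseteq> set xs - set ?ys"
  proof
    fix i assume "i \<in> {i \<in> {1..n}. Suc s \<le> b i}"
    then have "i \<in> {i \<in> {1..n}. s \<le> b i}" "\<not> b i < Suc s" by auto
    then show "i \<in> set xs - set ?ys" using assms(1) unfolding reachable_def by auto
  qed
  ultimately show ?thesis
    using assms(1,3) unfolding reachable_def survivors_def mem_Collect_eq by blast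
qed

text \<open>One round of the two inductions \<open>fair_coins\<close> and
  \<open>champion_prob_win\<close>: the later rounds need to be known at reachable lists
  only.\<close>

lemma later_reachable:
  assumes "matchup_table n p" "reachable s xs" "s < r"
    "\<And>zs. reachable (Suc s) zs \<Longrightarrow> pmf (later p b k (Suc s) (set zs)) S = f zs"
  shows "pmf (later p b (Suc k) s (set xs)) S =
    mean_over p (pairing (filter (\<lambda>i. b i < Suc s) xs)) xs f"
proof -
  have "even (length (filter (\<lambda>i. b i < Suc s) xs))"
    using reachable_length_players size_of_pos assms by simp
  then have "pmf (later p b (Suc k) s (set xs)) S =
    mean_over p (pairing (filter (\<lambda>i. b i < Suc s) xs)) xs (\<lambda>zs. pmf (later p b k (Suc s) (set zs)) S)"
    using assms(1,2) by (intro later_Suc) (auto simp: reachable_def)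
  also have "\<dots> = mean_over p (pairing (filter (\<lambda>i. b i < Suc s) xs)) xs f"
    by (rule mean_over_cong[OF reachable_admissible[OF assms(2,3)]])
      (use assms(4) reachable_survivors[OF assms(2,3)] in blast)
  finally show ?thesis .
qed

definition sizes :: "nat list" where
  "sizes = map size_of [0..<r]"

lemma reachable_r:
  assumes "reachable r xs" obtains x where "xs = [x]"
  using assms alive_r by (auto simp: reachable_def length_Suc_conv)

text \<open>After its byes a team plays in every round, hence has to win \<open>r - b i\<close> fair
  games.\<close>

lemma fair_coins:
  assumes "i \<in> {1..n}"
  shows "champion_prob n r b (\<lambda>_ _. 1 / 2) i = (1 / 2) ^ (r - b i)"
proof -
  \<comment> \<open>Here \<open>k\<close> rounds are left after round \<open>s\<close>. The
    truncated difference \<open>b i - s\<close> counts the byes still to come and is 0 for a team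
    that has already started to play.\<close>
  have "pmf (later (\<lambda>_ _. 1 / 2) b k s (set xs)) {i} =
      (if i \<in> set xs then (1 / 2) ^ (k - (b i - s)) else 0)" if "s + k = r" "reachable s xs" for s k xs
    using that
  proof (induction k arbitrary: s xs)
    case 0
    then obtain x where "xs = [x]" using reachable_r by auto
    then show ?case by (auto simp: pmf_return)
  next
    case (Suc k)
    let ?gs = "pairing (filter (\<lambda>i. b i < Suc s) xs)"
    have s: "s < r" using Suc.prems by simp
    have "even (length (filter (\<lambda>i. b i < Suc s) xs))"
      using reachable_length_players size_of_pos s Suc.prems by simp
    note st = set_teams_pairing[OF this]
    have "pmf (later (\<lambda>_ _. 1 / 2) b (Suc k) s (set xs)) {i} =
      mean_over (\<lambda>_ _. 1 / 2) ?gs xs (\<lambda>zs. if i \<in> set zs then (1 / 2) ^ (k - (b i - Suc s)) else 0)"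
    proof (rule later_reachable[OF _ Suc.prems(2) s])
      show "matchup_table n (\<lambda>_ _. 1 / 2)" by (simp add: matchup_table_def)
      show "pmf (later (\<lambda>_ _. 1 / 2) b k (Suc s) (set zs)) {i} =
          (if i \<in> set zs then (1 / 2) ^ (k - (b i - Suc s)) else 0)" if "reachable (Suc s) zs" for zs
        using Suc.prems(1) that by (intro Suc.IH) auto
    qed
    also have "\<dots> = (if i \<in> set xs then
        if i \<in> set (teams_of ?gs) then 1 / 2 * (1 / 2) ^ (k - (b i - Suc s))
        else (1 / 2) ^ (k - (b i - Suc s)) else 0)"
      by (rule mean_over_indicator[OF reachable_admissible[OF Suc.prems(2) s]]) auto
    also have "\<dots> = (if i \<in> set xs then (1 / 2) ^ (Suc k - (b i - s)) else 0)"
    proof (cases "b i < Suc s")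
      case False
      then have "Suc k - (b i - s) = k - (b i - Suc s)" by linarith
      then show ?thesis unfolding st using False by simp
    qed (simp only: st, simp)
    finally show ?case .
  qed
  from this[of 0 r, OF _ reachable_0] show ?thesis
    using assms by (simp add: champion_prob_later atLeastLessThanSuc_atLeastAtMost del: upt_Suc)
qed

lemma fits_sizes: "fits sizes n"
proof -
  have "s + k = r \<Longrightarrow> fits (map size_of [s..<r]) (alive s)" for k s
  proof (induction k arbitrary: s)
    case (Suc k)
    then have s: "s < r" by simp
    then have "[s..<r] = s # [Suc s..<r]" by (rule upt_conv_Cons)
    moreover have "fits (map size_of [Suc s..<r]) (alive (Suc s))"
      by (rule Suc.IH) (use Suc.prems in simp)
    ultimately show ?case using size_of_pos[OF s] size_of_eq[of s] alive_Suc[OF s] by simp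
  qed (simp add: alive_r)
  from this[of 0 r] show ?thesis by (simp add: sizes_def alive_0)
qed

end

text \<open>Applied to the condition of having fewer byes than the round number: it turns the
  players of a round into the lowest seeds once byes do not increase with the seed number.\<close>

lemma filter_upper_segment:
  assumes "sorted_wrt (<) xs" "\<And>x y. x \<in> set xs \<Longrightarrow> y \<in> set xs \<Longrightarrow> x < y \<Longrightarrow> P x \<Longrightarrow> P y"
  shows "filter P xs = last_of (length (filter P xs)) (xs :: nat list)"
  using assms
proof (induction xs)
  case (Cons a xs)
  show ?case
  proof (cases "P a")
    case True
    then have "filter P (a # xs) = a # xs" using Cons.prems by (auto simp: filter_id_conv)
    then show ?thesis by (simp add: last_of_def)
  next
    case False
    have "filter P xs = last_of (length (filter P xs)) xs"
      by (rule Cons.IH) (use Cons.prems in auto)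
    with False show ?thesis by (simp add: last_of_def Suc_diff_le)
  qed
qed (simp add: last_of_def)

context bracket
begin

text \<open>With such byes the players of a round are the lowest undefeated seeds, so only their
  number matters and \<open>sizes\<close> determines the tournament.\<close>

lemma champion_prob_win:
  assumes anti: "\<And>i j. i \<in> {1..n} \<Longrightarrow> j \<in> {1..n} \<Longrightarrow> i < j \<Longrightarrow> b j \<le> b i"
    and p: "matchup_table n p"
  shows "champion_prob n r b p i = win p sizes [1..<Suc n] i"
proof -
  have "pmf (later p b k s (set xs)) {i} = win p (map size_of [s..<r]) xs i"
    if "s + k = r" "reachable s xs" for s k xs
    using that
  proof (induction k arbitrary: s xs)
    case 0
    then obtain x where "xs = [x]" using reachable_r by auto
    with 0 show ?case by (auto simp: pmf_return)
  next
    case (Suc k)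
    have s: "s < r" using Suc.prems by simp
    have "filter (\<lambda>i. b i < Suc s) xs = last_of (length (filter (\<lambda>i. b i < Suc s) xs)) xs"
    proof (rule filter_upper_segment)
      show "sorted_wrt (<) xs" using Suc.prems by (simp add: reachable_def)
      show "b y < Suc s" if "x \<in> set xs" "y \<in> set xs" "x < y" "b x < Suc s" for x y
      proof -
        have "b y \<le> b x" using that Suc.prems(2) by (intro anti) (auto simp: reachable_def)
        then show ?thesis using that by simp
      qed
    qed
    then have "filter (\<lambda>i. b i < Suc s) xs = last_of (size_of s) xs"
      by (simp add: reachable_length_players[OF Suc.prems(2)])
    moreover have "[s..<r] = s # [Suc s..<r]" using s by (rule upt_conv_Cons)
    moreover have "pmf (later p b (Suc k) s (set xs)) {i} =
      mean_over p (pairing (filter (\<lambda>i. b i < Suc s) xs)) xs (\<lambda>zs. win p (map size_of [Suc s..<r]) zs i)"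
      by (rule later_reachable[OF p Suc.prems(2) s], rule Suc.IH) (use Suc.prems in auto)
    ultimately show ?case by simp
  qed
  from this[of 0 r, OF _ reachable_0] show ?thesis
    by (simp add: champion_prob_later sizes_def atLeastLessThanSuc_atLeastAtMost del: upt_Suc)
qed

text \<open>The condition on opponents holds automatically, since pairing by seed reverses the
  order; properness reduces to the condition on byes.\<close>

lemma proper_iff:
  "proper n r b \<longleftrightarrow> (\<forall>i\<in>{1..n}. \<forall>j\<in>{1..n}. i < j \<longrightarrow> b j \<le> b i)"
proof
  assume pr: "proper n r b"
  show "\<forall>i\<in>{1..n}. \<forall>j\<in>{1..n}. i < j \<longrightarrow> b j \<le> b i"
  proof (intro ballI impI, rule ccontr)
    fix i j assume ij: "i \<in> {1..n}" "j \<in> {1..n}" "i < j" "\<not> b j \<le> b i"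
    \<comment> \<open>In round \<open>b i + 1\<close> the team \<open>i\<close> plays while
      \<open>j\<close> still has a bye, and neither has played before.\<close>
    have "i \<in> undefeated n b chalk (b i)" "j \<in> undefeated n b chalk (b i)"
      using ij waiting_undefeated[of "b i" chalk] by auto
    moreover have "Suc (b i) \<in> {1..r}" using ij byes_le[of j] by auto
    moreover have "s \<in> {1..r} \<Longrightarrow> i \<in> undefeated n b chalk (s - 1) \<Longrightarrow>
        j \<in> undefeated n b chalk (s - 1) \<Longrightarrow> i < j \<Longrightarrow> s \<le> b j \<Longrightarrow> s \<le> b i" for s
      using pr unfolding proper_def Let_def by blast
    ultimately have "Suc (b i) \<le> b i" using ij(3,4) by (metis diff_Suc_1 not_less_eq_eq)
    then show False by simp
  qed
next
  assume anti: "\<forall>i\<in>{1..n}. \<forall>j\<in>{1..n}. i < j \<longrightarrow> b j \<le> b i"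
  have "y < x" if "finite U" "i < j" "meet b s U i x" "meet b s U j y" for s U i j x y
  proof -
    define xs where "xs = sorted_list_of_set (playing b s U)"
    define m where "m = length xs"
    have srt: "a < a' \<Longrightarrow> a' < m \<Longrightarrow> xs ! a < xs ! a'" for a a'
      unfolding xs_def m_def by (metis sorted_wrt_nth_less strict_sorted_list_of_set)
    \<comment> \<open>Seen from either of its teams, a game joins the positions \<open>a\<close> and
      \<open>m - 1 - a\<close>; this is the order reversal.\<close>
    have *: "\<exists>a<m. i = xs ! a \<and> x = xs ! (m - 1 - a)" if ix: "meet b s U i x" for i x
    proof -
      obtain k where k: "k < m div 2"
        "(i, x) = (xs ! k, xs ! (m - 1 - k)) \<or> (x, i) = (xs ! k, xs ! (m - 1 - k))"
        using ix unfolding meet_def games_def Let_def xs_def m_def by blast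
      from k(2) show ?thesis
      proof
        assume "(x, i) = (xs ! k, xs ! (m - 1 - k))"
        then show ?thesis using k(1) by (intro exI[of _ "m - 1 - k"]) auto
      next
        assume "(i, x) = (xs ! k, xs ! (m - 1 - k))"
        then show ?thesis using k(1) by (intro exI[of _ k]) auto
      qed
    qed
    from *[OF that(3)] obtain a where a: "a < m" "i = xs ! a" "x = xs ! (m - 1 - a)" by auto
    from *[OF that(4)] obtain a' where a': "a' < m" "j = xs ! a'" "y = xs ! (m - 1 - a')" by auto
    have "a < a'" using srt[of a' a] a a' \<open>i < j\<close> by (metis linorder_neqE_nat order_less_asym)
    then show ?thesis using srt[of "m - 1 - a'" "m - 1 - a"] a a' by simp
  qed
  note meet = this
  have main: "(s \<le> b j \<longrightarrow> s \<le> b i) \<and> (\<forall>x y. meet b s (undefeated n b chalk t) i x \<and>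
      meet b s (undefeated n b chalk t) j y \<longrightarrow> y < x)"
    if "i \<in> undefeated n b chalk t" "j \<in> undefeated n b chalk t" "i < j" for i j s t
  proof -
    have "b j \<le> b i" using that anti undefeated_subset[of chalk t] by blast
    then show ?thesis using meet[OF finite_undefeated \<open>i < j\<close>] by auto
  qed
  show "proper n r b" unfolding proper_def Let_def
    by (intro conjI[OF bracket] ballI impI, rule main)
qed

end

subsection \<open>Signatures and round sizes\<close>

inductive good_sizes :: "nat list \<Rightarrow> bool" where
  "good_sizes []"
| "good_sizes ms \<Longrightarrow> good_sizes (2 # ms)"
| "good_sizes ms \<Longrightarrow> good_sizes (4 # 2 # ms)"
| "good_sizes ms \<Longrightarrow> good_sizes (4 # 4 # 2 # ms)"

text \<open>The signature is recovered from the round sizes; \<open>c\<close> is the number of players inherited from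
  the previous round.\<close>

fun sig_from :: "nat \<Rightarrow> nat list \<Rightarrow> nat list" where
  "sig_from c [] = [1 - c]"
| "sig_from c (m # ms) = (m - c) # sig_from (m div 2) ms"

text \<open>Rules out truncation in \<open>sig_from\<close>: the winners of a round all play in the
  next one, so \<open>c\<close> never exceeds the next round size.\<close>

fun chained :: "nat \<Rightarrow> nat list \<Rightarrow> bool" where
  "chained c [] \<longleftrightarrow> c \<le> 1"
| "chained c (m # ms) \<longleftrightarrow> c \<le> m \<and> even m \<and> 0 < m \<and> chained (m div 2) ms"

lemma sig_from_nonempty: "sig_from c ms \<noteq> []"
  by (cases ms) auto

lemma prepended_nonempty: "prepended l \<Longrightarrow> l \<noteq> []"
  by (induction rule: prepended.induct) auto

text \<open>Each block ends with a single game, so its winner is the one player inherited by the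
  next block; this is the value 1 of \<open>c\<close>.\<close>

lemma good_sizes_prepended: "good_sizes ms \<Longrightarrow> prepended (sig_from 1 ms)"
proof (induction rule: good_sizes.induct)
  case (2 ms)
  then show ?case using prepended.intros(2) by simp
next
  case (3 ms)
  then show ?case using prepended.intros(3)[OF 3(2)] by simp
next
  case (4 ms)
  then show ?case using prepended.intros(4)[OF 4(2)] by simp
qed (simp add: prepended.intros)

lemma sig_from_Cons:
  assumes "sig_from c ms = x # l" "l \<noteq> []"
  obtains m ms' where "ms = m # ms'" "x = m - c" "sig_from (m div 2) ms' = l"
  using assms by (cases ms) auto

lemma prepended_good_sizes:
  "prepended l \<Longrightarrow> sig_from 1 ms = l \<Longrightarrow> chained 1 ms \<Longrightarrow> good_sizes ms"
proof (induction arbitrary: ms rule: prepended.induct)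
  case 1
  then show ?case
    by (cases ms) (auto simp: sig_from_nonempty intro: good_sizes.intros)
next
  case (2 l)
  from 2(3) have "sig_from 1 ms = 1 # l" by simp
  then obtain m ms' where m: "ms = m # ms'" "1 = m - 1" "sig_from (m div 2) ms' = l"
    using prepended_nonempty[OF 2(1)] by (rule sig_from_Cons)
  then have "m = 2" by linarith
  then show ?case using m 2 by (auto intro: good_sizes.intros)
next
  case (3 l)
  from 3(3) have "sig_from 1 ms = 3 # 0 # l" by simp
  then obtain m ms' where m: "ms = m # ms'" "3 = m - 1" "sig_from (m div 2) ms' = 0 # l"
    by (rule sig_from_Cons) auto
  then have m4: "m = 4" by linarith
  from m(3) obtain m' ms'' where m': "ms' = m' # ms''" "0 = m' - m div 2" "sig_from (m' div 2) ms'' = l"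
    using prepended_nonempty[OF 3(1)] by (rule sig_from_Cons)
  \<comment> \<open>The entry 0 shows only that \<open>m'\<close> is at most 2, as subtraction
    truncates; \<open>chained\<close> gives the other bound.\<close>
  have "m' = 2" using 3(4) m(1) m'(1,2) m4 by auto
  then show ?case using m m' m4 3 by (auto intro: good_sizes.intros)
next
  case (4 l)
  from 4(3) have "sig_from 1 ms = 3 # 2 # 0 # l" by simp
  then obtain m ms' where m: "ms = m # ms'" "3 = m - 1" "sig_from (m div 2) ms' = 2 # 0 # l"
    by (rule sig_from_Cons) auto
  then have m4: "m = 4" by linarith
  from m(3) obtain m' ms'' where m': "ms' = m' # ms''" "2 = m' - m div 2" "sig_from (m' div 2) ms'' = 0 # l"
    by (rule sig_from_Cons) auto
  then have m4': "m' = 4" using m4 by linarith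
  from m'(3) obtain m'' ms3 where m'': "ms'' = m'' # ms3" "0 = m'' - m' div 2" "sig_from (m'' div 2) ms3 = l"
    using prepended_nonempty[OF 4(1)] by (rule sig_from_Cons)
  have "m'' = 2" using 4(4) m(1) m'(1) m''(1,2) m4 m4' by auto
  then show ?case using m m' m'' m4 m4' 4 by (auto intro: good_sizes.intros)
qed

text \<open>Adding 1 to the first entry replaces the team inherited from an earlier block by one
  that starts in the first round: \<open>c\<close> drops from 1 to 0.\<close>

lemma generated_sig_from:
  assumes "chained 0 ms" shows "generated (sig_from 0 ms) \<longleftrightarrow> good_sizes ms"
proof -
  have "chained 1 ms" using assms by (cases ms) auto
  then have *: "prepended (sig_from 1 ms) \<longleftrightarrow> good_sizes ms"
    using good_sizes_prepended prepended_good_sizes by blast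
  have "\<exists>x xs. sig_from 1 ms = x # xs \<and> sig_from 0 ms = (x + 1) # xs"
    using assms by (cases ms) auto
  then obtain x xs where x: "sig_from 1 ms = x # xs" "sig_from 0 ms = (x + 1) # xs" by blast
  then show ?thesis unfolding *[symmetric] by (auto simp: generated_def)
qed

context bracket
begin

lemma signature_sizes: "signature n r b = sig_from 0 sizes" and chained_sizes: "chained 0 sizes"
proof -
  have w: "card {i \<in> {1..n}. b i = s} + waiting (Suc s) = waiting s" for s
  proof -
    have "{i \<in> {1..n}. s \<le> b i} = {i \<in> {1..n}. b i = s} \<union> {i \<in> {1..n}. Suc s \<le> b i}" by auto
    moreover have "card ({i \<in> {1..n}. b i = s} \<union> {i \<in> {1..n}. Suc s \<le> b i}) =
        card {i \<in> {1..n}. b i = s} + card {i \<in> {1..n}. Suc s \<le> b i}"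
      by (rule card_Un_disjoint) auto
    ultimately show ?thesis by (simp add: waiting_def)
  qed
  have wr: "waiting (Suc r) = 0" using byes_le by (fastforce simp: waiting_def)
  \<comment> \<open>The number \<open>c\<close> of winners of the previous round is expressed as the
    excess of the undefeated teams over those with at least \<open>s\<close> byes.\<close>
  have main: "map (\<lambda>k. card {i \<in> {1..n}. b i = k}) [s..<Suc r] = sig_from c (map size_of [s..<r]) \<and>
      chained c (map size_of [s..<r])" if "s + k = r" "alive s = waiting s + c" for s k c
    using that
  proof (induction k arbitrary: s c)
    case 0
    then have "card {i \<in> {1..n}. b i = r} = 1 - c" "c \<le> 1"
      using w[of r] wr alive_r by auto
    with 0 show ?case by simp
  next
    case (Suc k)
    then have s: "s < r" by simp
    have c: "size_of s = card {i \<in> {1..n}. b i = s} + c" using w[of s] size_of_eq[of s] Suc.prems(2) by simp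
    have "even (size_of s)" using size_of_pos[OF s] by simp
    then have "alive (Suc s) = waiting (Suc s) + size_of s div 2"
      using alive_Suc[OF s] size_of_eq[of s] by (auto elim: evenE)
    then have "map (\<lambda>k. card {i \<in> {1..n}. b i = k}) [Suc s..<Suc r] =
        sig_from (size_of s div 2) (map size_of [Suc s..<r]) \<and>
        chained (size_of s div 2) (map size_of [Suc s..<r])"
      by (intro Suc.IH) (use Suc.prems in auto)
    moreover have "[s..<r] = s # [Suc s..<r]" "[s..<Suc r] = s # [Suc s..<Suc r]"
      using s by (auto simp: upt_conv_Cons simp del: upt_Suc)
    ultimately show ?case using c size_of_pos[OF s] by (simp del: upt_Suc)
  qed
  have "{i \<in> {1..n}. 0 \<le> b i} = {1..n}" by auto
  then have "alive 0 = waiting 0 + 0" by (simp add: alive_0 waiting_def)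
  note main[OF add_0 this]
  then have "map (\<lambda>k. card {i \<in> {1..n}. b i = k}) [0..<Suc r] = sig_from 0 sizes \<and>
      chained 0 sizes"
    unfolding sizes_def .
  then show "signature n r b = sig_from 0 sizes" "chained 0 sizes" unfolding signature_def by blast+
qed

end

text \<open>Read the sizes from the end up to the first round \<open>m\<close> that spoils a good
  list. Winners all play on, so \<open>m\<close> is at most twice the next size, hence at most 8; it
  is not 2, and it can be 4 only before \<open>4, 4, 2\<close>. The bad pattern is \<open>m\<close>
  together with the block that follows.\<close>

lemma bad_sizes_split:
  assumes "chained c ms" "\<not> good_sizes ms"
  shows "\<exists>pre g suf. ms = pre @ g @ suf \<and>
    g \<in> {[6, 4, 2], [8, 4, 2], [4, 4, 4, 2], [6, 4, 4, 2], [8, 4, 4, 2]}"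
  using assms
proof (induction ms arbitrary: c)
  case Nil
  then show ?case by (simp add: good_sizes.intros)
next
  case (Cons m ms)
  show ?case
  proof (cases "good_sizes ms")
    case False
    then obtain pre g suf where "ms = pre @ g @ suf"
      and g: "g \<in> {[6, 4, 2], [8, 4, 2], [4, 4, 4, 2], [6, 4, 4, 2], [8, 4, 4, 2]}"
      using Cons.IH[of "m div 2"] Cons.prems(1) by auto
    then have "m # ms = (m # pre) @ g @ suf" by simp
    with g show ?thesis by blast
  next
    case True
    have m: "even m" "0 < m" "chained (m div 2) ms" using Cons.prems by auto
    have m2: "m \<noteq> 2" using True Cons.prems(2) good_sizes.intros(2) by blast
    have le8: "m = 4 \<or> m = 6 \<or> m = 8" if "m div 2 \<le> 4"
    proof -
      have "m \<le> 9" using that by simp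
      moreover have "m \<noteq> 1 \<and> m \<noteq> 3 \<and> m \<noteq> 5 \<and> m \<noteq> 7 \<and> m \<noteq> 9" using m(1) by auto
      ultimately show ?thesis using m(2) m2 by presburger
    qed
    show ?thesis using True
    proof cases
      case 1
      then have "m \<le> 3" using m(3) by simp
      then have "m = 2" using m(1,2) by (cases "m = 1 \<or> m = 3") auto
      with m2 show ?thesis by simp
    next
      case (2 ms')
      then have "m div 2 \<le> 2" using m(3) by simp
      then have "m \<le> 5" by linarith
      then have "m = 4" using m(1,2) m2 by (cases "m = 1 \<or> m = 3 \<or> m = 5") auto
      with Cons.prems(2) 2 show ?thesis using good_sizes.intros(3) by blast
    next
      case (3 ms')
      then have "m div 2 \<le> 4" using m(3) by simp
      from le8[OF this] Cons.prems(2) 3 have "m = 6 \<or> m = 8" using good_sizes.intros(4) by blast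
      moreover have "m # ms = [] @ [m, 4, 2] @ ms'" using 3 by simp
      ultimately show ?thesis by blast
    next
      case (4 ms')
      then have "m div 2 \<le> 4" using m(3) by simp
      note le8[OF this]
      moreover have "m # ms = [] @ [m, 4, 4, 2] @ ms'" using 4 by simp
      ultimately show ?thesis by blast
    qed
  qed
qed

subsection \<open>Composition of ordered blocks\<close>

text \<open>The list \<open>T @ [x, y]\<close> expresses that \<open>x\<close> and \<open>y\<close>
  both rank below \<open>T\<close>, with \<open>y\<close> the weaker; they compete for the same
  lowest place in two separate tournaments.\<close>

definition ordered_block :: "nat \<Rightarrow> (nat \<Rightarrow> nat \<Rightarrow> real) \<Rightarrow> nat list \<Rightarrow> bool" where
  "ordered_block n p g \<longleftrightarrow>
     (\<forall>xs. sorted_wrt (<) xs \<and> set xs \<subseteq> {1..n} \<and> fits g (length xs) \<longrightarrow>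
        (\<forall>i\<in>set xs. \<forall>j\<in>set xs. i < j \<longrightarrow> win p g xs j \<le> win p g xs i)) \<and>
     (\<forall>T x y. sorted_wrt (<) (T @ [x, y]) \<and> set (T @ [x, y]) \<subseteq> {1..n} \<and> fits g (length T + 1) \<longrightarrow>
        win p g (T @ [y]) y \<le> win p g (T @ [x]) x)"

lemma ordered_blockD1:
  "ordered_block n p g \<Longrightarrow> sorted_wrt (<) xs \<Longrightarrow> set xs \<subseteq> {1..n} \<Longrightarrow> fits g (length xs) \<Longrightarrow>
    i \<in> set xs \<Longrightarrow> j \<in> set xs \<Longrightarrow> i < j \<Longrightarrow> win p g xs j \<le> win p g xs i"
  by (simp add: ordered_block_def)

lemma ordered_blockD2:
  "ordered_block n p g \<Longrightarrow> sorted_wrt (<) (T @ [x, y]) \<Longrightarrow> set (T @ [x, y]) \<subseteq> {1..n} \<Longrightarrow>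
    fits g (length T + 1) \<Longrightarrow> win p g (T @ [y]) y \<le> win p g (T @ [x]) x"
  by (simp add: ordered_block_def)

text \<open>By \<open>win_append\<close> the chances are averages over the winner \<open>x\<close>
  of the bottom block \<open>B\<close>. Two teams of \<open>B\<close> are compared factor by factor,
  two teams above \<open>B\<close> for each \<open>x\<close> separately.\<close>

lemma ordered_block_append:
  assumes p: "matchup_table n p" and g: "fits g k" "ordered_block n p g" and ms: "ordered_block n p ms"
  shows "ordered_block n p (g @ ms)"
proof -
  have p0: "0 \<le> p x y" if "x \<in> {1..n}" "y \<in> {1..n}" for x y
    using p that by (auto simp: matchup_table_def)
  have nn: "0 \<le> win p g B x" if "set B \<subseteq> {1..n}" "sorted_wrt (<) B" "fits g (length B)" for B x
    by (rule win_nonneg[OF p0 that(1,3,2)])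
  note own = win_append_bottom[of _ _ g _ p ms]
  have nn': "0 \<le> win p ms (T @ [x]) i"
    if "sorted_wrt (<) (T @ [x])" "set (T @ [x]) \<subseteq> {1..n}" "fits ms (length T + 1)" for T x i
    by (rule win_nonneg[OF p0 that(2) _ that(1)]) (use that in auto)
  have 1: "win p (g @ ms) xs j \<le> win p (g @ ms) xs i"
    if xs: "sorted_wrt (<) xs" "set xs \<subseteq> {1..n}" "fits (g @ ms) (length xs)"
      and ij: "i \<in> set xs" "j \<in> set xs" "i < j" for xs i j
  proof -
    have k: "k \<le> length xs" "fits ms (length xs - k + 1)" using fits_append[OF xs(3) g(1)] by auto
    define T where "T = take (length xs - k) xs"
    define B where "B = drop (length xs - k) xs"
    have TB: "xs = T @ B" by (simp add: T_def B_def)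
    have len: "length B = k" "length T = length xs - k" using k by (auto simp: T_def B_def)
    have fB: "fits g (length B)" "fits ms (length T + 1)" using len g k by auto
    have sB: "sorted_wrt (<) B" "set B \<subseteq> {1..n}" using xs TB by (auto simp: sorted_wrt_append)
    have sT: "sorted_wrt (<) (T @ [x])" "set (T @ [x]) \<subseteq> {1..n}" if "x \<in> set B" for x
      using xs TB that by (auto simp: sorted_wrt_append)
    have T: "win p ms (T @ [x]) b \<le> win p ms (T @ [x]) a"
      if "x \<in> set B" "a \<in> set (T @ [x])" "b \<in> set (T @ [x])" "a < b" for x a b
      by (rule ordered_blockD1[OF ms sT[OF that(1)] _ that(2-4)]) (use fB in auto)
    show ?thesis
    proof (cases "i \<in> set B")
      case True
      then have j: "j \<in> set B" using ij TB xs(1) by (fastforce simp: sorted_wrt_append)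
      have "win p g B j \<le> win p g B i"
        by (rule ordered_blockD1[OF g(2) sB fB(1) True j ij(3)])
      moreover have "win p ms (T @ [j]) j \<le> win p ms (T @ [i]) i"
      proof (rule ordered_blockD2[OF ms])
        show "sorted_wrt (<) (T @ [i, j])" using xs(1) TB True j ij(3) by (auto simp: sorted_wrt_append)
        show "set (T @ [i, j]) \<subseteq> {1..n}" using xs(2) ij TB by auto
      qed (use fB in auto)
      ultimately show ?thesis
        unfolding TB own[OF xs(1)[unfolded TB] fB(1) True] own[OF xs(1)[unfolded TB] fB(1) j]
        using nn[OF sB(2,1) fB(1)] nn'[OF sT(1)[OF j] sT(2)[OF j] fB(2)] by (intro mult_mono) auto
    next
      case False
      then have i: "i \<in> set T" using ij TB by auto
      note eq = win_append[OF xs(1)[unfolded TB] fB(1)]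
      show ?thesis
      proof (cases "j \<in> set B")
        case True
        have "win p (g @ ms) xs j = win p g B j * win p ms (T @ [j]) j"
          unfolding TB by (rule own[OF xs(1)[unfolded TB] fB(1) True])
        \<comment> \<open>If \<open>j\<close> wins the bottom block, it is the lowest seed of
          \<open>T @ [j]\<close>, where \<open>i\<close> does at least as well; other winners of
          \<open>B\<close> can only add to the chances of \<open>i\<close>.\<close>
        also have "\<dots> \<le> win p g B j * win p ms (T @ [j]) i"
          by (intro mult_left_mono T nn sB fB) (use True i ij(3) in auto)
        also have "\<dots> \<le> (\<Sum>x\<in>set B. win p g B x * win p ms (T @ [x]) i)"
        proof (rule member_le_sum[OF True])
          show "0 \<le> win p g B x * win p ms (T @ [x]) i" if "x \<in> set B - {j}" for x
            using nn[OF sB(2,1) fB(1)] nn'[OF sT fB(2)] that by (intro mult_nonneg_nonneg) auto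
        qed simp
        finally show ?thesis unfolding TB eq .
      next
        case F: False
        then have j: "j \<in> set T" using ij TB by auto
        show ?thesis unfolding TB eq
          by (intro sum_mono mult_left_mono T nn sB fB) (use i j ij(3) in auto)
      qed
    qed
  qed
  have 2: "win p (g @ ms) (T @ [y]) y \<le> win p (g @ ms) (T @ [x]) x"
    if T: "sorted_wrt (<) (T @ [x, y])" "set (T @ [x, y]) \<subseteq> {1..n}" "fits (g @ ms) (length T + 1)"
    for T x y
  proof -
    have k: "k \<le> length T + 1" "fits ms (length T + 1 - k + 1)" using fits_append[OF T(3) g(1)] by auto
    \<comment> \<open>Since \<open>k\<close> is positive, the replaced team belongs to the bottom
      block; the other \<open>k - 1\<close> teams of the block are the end of
      \<open>T\<close>.\<close>
    have "k > 0" using g(1) by (cases g) auto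
    define A where "A = take (length T + 1 - k) T"
    define B where "B = drop (length T + 1 - k) T"
    have AB: "T = A @ B" by (simp add: A_def B_def)
    have len: "length B + 1 = k" "length A = length T + 1 - k" using k \<open>k > 0\<close> by (auto simp: A_def B_def)
    have fg: "fits g (length B + 1)" "fits ms (length A + 1)" using len g(1) k by auto
    have srt: "sorted_wrt (<) (A @ (B @ [x, y]))" using T(1) AB by simp
    then have srt': "sorted_wrt (<) (B @ [x, y])" "sorted_wrt (<) (A @ [x, y])"
      "sorted_wrt (<) (B @ [x])" "sorted_wrt (<) (B @ [y])"
      "sorted_wrt (<) (A @ [x])" "sorted_wrt (<) (A @ [y])"
      "sorted_wrt (<) (A @ (B @ [x]))" "sorted_wrt (<) (A @ (B @ [y]))"
      by (simp_all add: sorted_wrt_append)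
    have sub: "set (B @ [x, y]) \<subseteq> {1..n}" "set (A @ [x, y]) \<subseteq> {1..n}"
      "set (B @ [x]) \<subseteq> {1..n}" "set (A @ [y]) \<subseteq> {1..n}" using T(2) AB by auto
    have "win p g (B @ [y]) y \<le> win p g (B @ [x]) x"
      by (rule ordered_blockD2[OF g(2) srt'(1) sub(1) fg(1)])
    moreover have "win p ms (A @ [y]) y \<le> win p ms (A @ [x]) x"
      by (rule ordered_blockD2[OF ms srt'(2) sub(2) fg(2)])
    moreover have "0 \<le> win p g (B @ [x]) x" by (rule nn[OF sub(3) srt'(3)]) (use fg in simp)
    moreover have "0 \<le> win p ms (A @ [y]) y" by (rule nn'[OF srt'(6) sub(4) fg(2)])
    moreover have "win p (g @ ms) (A @ (B @ [x])) x = win p g (B @ [x]) x * win p ms (A @ [x]) x"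
      by (rule own[OF srt'(7)]) (use fg in auto)
    moreover have "win p (g @ ms) (A @ (B @ [y])) y = win p g (B @ [y]) y * win p ms (A @ [y]) y"
      by (rule own[OF srt'(8)]) (use fg in auto)
    ultimately show ?thesis unfolding AB by (simp add: mult_mono)
  qed
  from 1 2 show ?thesis unfolding ordered_block_def by blast
qed

subsection \<open>Bad blocks of rounds\<close>

lemma removeAll_map_inj:
  "inj_on f (insert x (set xs)) \<Longrightarrow> removeAll (f x) (map f xs) = map f (removeAll x xs)"
  by (induction xs) (auto simp: inj_on_def)

lemma pairing_map: "pairing (map f ys) = map (map_prod f f) (pairing ys)"
  by (simp add: pairing_def take_map rev_map zip_map_map map_prod_def)

lemma last_of_map: "last_of m (map f xs) = map f (last_of m xs)"
  by (simp add: last_of_def drop_map)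

text \<open>Each game contributes one factor \<open>c\<close>; the factor \<open>d\<close> clears
  the denominators of the rounds still to come. The map \<open>h\<close> renames the teams of a
  block to their seeds in the full bracket.\<close>

lemma mean_over_rescale:
  fixes p :: "nat \<Rightarrow> nat \<Rightarrow> real" and w :: "nat \<Rightarrow> nat \<Rightarrow> int"
  assumes "inj_on h A" "\<And>x y. x \<in> A \<Longrightarrow> y \<in> A \<Longrightarrow> c * p (h x) (h y) = of_int (w x y)"
    "set (teams_of gs) \<subseteq> A" "set L \<subseteq> A"
    "admissible gs L" "\<And>zs. zs \<in> survivors gs L \<Longrightarrow> d * f (map h zs) = of_int (g zs)"
  shows "c ^ length gs * d * mean_over p (map (map_prod h h) gs) (map h L) f =
    of_int (mean_over w gs L g)"
  using assms(3-)
proof (induction gs arbitrary: L)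
  case Nil
  then show ?case by (simp add: survivors_def admissible_def)
next
  case (Cons a gs)
  obtain i j where a: "a = (i, j)" by force
  note ac = admissible_Cons[OF Cons.prems(3)[unfolded a]]
  note sc = survivors_Cons[OF Cons.prems(3)[unfolded a]]
  have ij: "i \<in> A" "j \<in> A" using Cons.prems(1) a by auto
  have r: "removeAll (h x) (map h L) = map h (removeAll x L)" if "x \<in> A" for x
    using that Cons.prems(2) by (intro removeAll_map_inj inj_on_subset[OF assms(1)]) auto
  have IH: "c ^ length gs * d * mean_over p (map (map_prod h h) gs) (map h (removeAll x L)) f =
      of_int (mean_over w gs (removeAll x L) g)" if "x \<in> {i, j}" for x
    by (rule Cons.IH) (use Cons.prems a ac sc that in auto)
  have "c ^ length (a # gs) * d * mean_over p (map (map_prod h h) (a # gs)) (map h L) f =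
    (c * p (h i) (h j)) * (c ^ length gs * d * mean_over p (map (map_prod h h) gs) (map h (removeAll j L)) f) +
    (c * p (h j) (h i)) * (c ^ length gs * d * mean_over p (map (map_prod h h) gs) (map h (removeAll i L)) f)"
    using ij by (simp add: a r algebra_simps)
  then show ?case using IH ij by (simp add: a assms(2))
qed

text \<open>Carries an exact integer computation over to real probabilities; the exponent is the
  total number of games.\<close>

lemma win_rescale:
  fixes p :: "nat \<Rightarrow> nat \<Rightarrow> real" and w :: "nat \<Rightarrow> nat \<Rightarrow> int"
  assumes "inj_on h A" "\<And>x y. x \<in> A \<Longrightarrow> y \<in> A \<Longrightarrow> c * p (h x) (h y) = of_int (w x y)"
    "set xs \<subseteq> A" "i \<in> A" "fits ms (length xs)" "sorted_wrt (<) xs"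
  shows "c ^ (sum_list (map (\<lambda>m. m div 2) ms)) * win p ms (map h xs) (h i) = of_int (win w ms xs i)"
  using assms(3-)
proof (induction ms arbitrary: xs)
  case Nil
  then obtain x where "xs = [x]" by (auto simp: length_Suc_conv)
  then show ?case using Nil assms(1) by (auto simp: inj_on_def)
next
  case (Cons m ms)
  then have m: "even m" "m \<le> length xs" by auto
  let ?gs = "pairing (last_of m xs)" and ?d = "c ^ (sum_list (map (\<lambda>m. m div 2) ms))"
  have ad: "admissible ?gs xs" using admissible_pairing m Cons.prems by blast
  have len: "length ?gs = m div 2" by (rule length_pairing_last_of[OF m(2)])
  have "c ^ length ?gs * ?d * mean_over p (map (map_prod h h) ?gs) (map h xs) (\<lambda>zs. win p ms zs (h i)) =
      of_int (mean_over w ?gs xs (\<lambda>zs. win w ms zs i))"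
  proof (rule mean_over_rescale[where h = h and A = A and c = c and p = p and w = w, OF assms(1,2)])
    show "set (teams_of ?gs) \<subseteq> A" using ad Cons.prems(1) by (auto simp: admissible_def)
    show "?d * win p ms (map h zs) (h i) = of_int (win w ms zs i)" if "zs \<in> survivors ?gs xs" for zs
      using that Cons.prems length_survivors[OF that m(2)]
      by (intro Cons.IH) (auto simp: survivors_def)
  qed (use ad Cons.prems in auto)
  then show ?case by (simp add: len last_of_map pairing_map power_add)
qed

text \<open>In each round of \<open>pre\<close> the lower half of the players is numbered above
  \<open>N\<close> and loses with certainty to the upper half, so the lowest \<open>m div 2\<close>
  teams disappear.\<close>

lemma win_chalk:
  assumes "\<And>x y. 0 < x \<Longrightarrow> x < y \<Longrightarrow> y \<le> n \<Longrightarrow> N < y \<Longrightarrow> p x y = 1 \<and> p y x = 0"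
    "fits (pre @ ms) n" "N = n - sum_list (map (\<lambda>m. m div 2) pre)"
  shows "fits ms N \<and> win p (pre @ ms) [1..<Suc n] i = win p ms [1..<Suc N] i"
  using assms
proof (induction pre arbitrary: n)
  case (Cons m pre)
  have m: "even m" "m \<le> n" "fits (pre @ ms) (n - m div 2)" using Cons.prems(2) by auto
  define ys where "ys = last_of m [1..<Suc n]"
  have ys: "ys = [Suc (n - m)..<Suc n]" using m by (simp add: ys_def last_of_def del: upt_Suc)
  have len: "length ys = m" using m(2) by (simp add: ys_def length_last_of del: upt_Suc)
  have "snd ` set (pairing ys) = set (drop (m div 2) ys)"
    using map_snd_pairing_even[of ys] m(1) len by (metis list.set_map set_rev)
  also have "\<dots> = {n - m div 2 <.. n}"
  proof -
    have "Suc (n - m) + m div 2 = Suc (n - m div 2)" using m by (auto elim!: evenE)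
    then show ?thesis by (auto simp: ys simp del: upt_Suc)
  qed
  finally have snd: "snd ` set (pairing ys) = {n - m div 2 <.. n}" .
  have "filter (\<lambda>x. x \<notin> snd ` set (pairing ys)) [1..<Suc n] = [1..<Suc (n - m div 2)]"
    unfolding snd
    by (rule sorted_distinct_set_unique) (auto simp: sorted_wrt_filter simp del: upt_Suc)
  moreover have "mean_over p (pairing ys) [1..<Suc n] f =
      f (filter (\<lambda>x. x \<notin> snd ` set (pairing ys)) [1..<Suc n])" for f
  proof (rule mean_over_chalk)
    fix x y assume xy: "(x, y) \<in> set (pairing ys)"
    have "x < y" by (rule pairing_less[OF _ _ xy]) (use len m ys in \<open>auto simp: sorted_wrt_upt simp del: upt_Suc\<close>)
    moreover have "x \<in> set ys"
      using xy set_teams_pairing[of ys] len m(1) by force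
    then have "0 < x" by (auto simp: ys simp del: upt_Suc)
    moreover have "y \<in> {n - m div 2 <.. n}" using xy snd by force
    moreover have "N \<le> n - m div 2" using Cons.prems(3) by simp
    ultimately show "p x y = 1 \<and> p y x = 0" by (intro Cons.prems(1)) auto
  qed
  moreover have "fits ms N \<and> win p (pre @ ms) [1..<Suc (n - m div 2)] i = win p ms [1..<Suc N] i"
    by (rule Cons.IH) (use Cons.prems m(3) in auto)
  ultimately show ?case by (simp add: ys_def del: upt_Suc)
qed simp

lemma le_last: "sorted_wrt (<) xs \<Longrightarrow> x \<in> set xs \<Longrightarrow> x \<le> (last xs :: nat)"
  by (induction xs) (auto intro: less_imp_le)

text \<open>The players are always the lowest seeds, so the weakest team plays in every round, each
  time with chance \<open>u\<close>.\<close>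

lemma win_bottom:
  assumes "sorted_wrt (<) xs" "x \<in> set xs" "\<And>y. y \<in> set xs \<Longrightarrow> y \<noteq> x \<Longrightarrow> y < x \<and> p x y = u"
    "\<And>y z. y \<in> set xs \<Longrightarrow> z \<in> set xs \<Longrightarrow> p y z + p z y = 1" "fits ms (length xs)"
  shows "win p ms xs x = u ^ length ms"
  using assms
proof (induction ms arbitrary: xs)
  case Nil
  then show ?case by (auto simp: length_Suc_conv)
next
  case (Cons m ms)
  then have m: "even m" "0 < m" "m \<le> length xs" "fits ms (length xs - m div 2)" by auto
  let ?gs = "pairing (last_of m xs)"
  have ad: "admissible ?gs xs" using admissible_pairing m Cons.prems by blast
  have "win p (m # ms) xs x = mean_over p ?gs xs (\<lambda>zs. if x \<in> set zs then u ^ length ms else 0)"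
    unfolding win.simps
  proof (rule mean_over_cong[OF ad])
    fix zs assume zs: "zs \<in> survivors ?gs xs"
    then have sub: "set zs \<subseteq> set xs" "sorted_wrt (<) zs" by (auto simp: survivors_def)
    have "fits ms (length zs)" using length_survivors[OF zs m(3)] m(4) by simp
    then have "win p ms zs x = u ^ length ms" if "x \<in> set zs"
      using that sub Cons.prems(3,4) by (intro Cons.IH) blast+
    then show "win p ms zs x = (if x \<in> set zs then u ^ length ms else 0)" by (simp add: win_eq_0)
  qed
  also have "\<dots> = (if x \<in> set xs then if x \<in> set (teams_of ?gs) then u * u ^ length ms else u ^ length ms else 0)"
  proof (rule mean_over_indicator[OF ad])
    fix y z assume yz: "(y, z) \<in> set ?gs"
    then have "y < z" using m Cons.prems(1)
      by (intro pairing_less[OF _ _ yz]) (auto simp: length_last_of sorted_last_of)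
    moreover have "y \<in> set xs" "z \<in> set xs" using pairing_mem[OF yz] set_last_of[of m xs] by auto
    ultimately show "p y z + p z y = 1 \<and> (y = x \<longrightarrow> p y z = u) \<and> (z = x \<longrightarrow> p z y = u)"
      using Cons.prems(3,4) by auto
  qed
  also have "\<dots> = u ^ length (m # ms)"
  proof -
    have "xs \<noteq> []" using m by auto
    then have "last xs = x"
      using le_last[OF Cons.prems(1,2)] Cons.prems(3)[of "last xs"] by fastforce
    moreover have "last (last_of m xs) = last xs" "last_of m xs \<noteq> []" using m by (auto simp: last_of_def)
    ultimately have "x \<in> set (last_of m xs)" by (metis last_in_set)
    then have "x \<in> set (teams_of ?gs)"
      using set_teams_pairing[of "last_of m xs"] length_last_of[OF m(3)] m(1) by simp
    then show ?thesis using Cons.prems(2) by simp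
  qed
  finally show ?case .
qed

subsection \<open>Two-valued tables\<close>

text \<open>Two levels of strength suffice for counterexamples: \<open>th i\<close> is the first
  seed against which \<open>i\<close> is a 3 to 1 favourite instead of even. Teams after
  \<open>N\<close> are certain losers, to be eliminated before the block starts.\<close>

definition threshold_table :: "nat \<Rightarrow> (nat \<Rightarrow> nat) \<Rightarrow> nat \<Rightarrow> nat \<Rightarrow> real" where
  "threshold_table N th i j =
     (let u = (\<lambda>i j. if N < j then 1 else if th i \<le> j then 3 / 4 else 1 / 2)
      in if i < j then u i j else if j < i then 1 - u j i else 1 / 2)"

lemma SST_threshold_table:
  assumes "\<And>i j. 0 < i \<Longrightarrow> i \<le> j \<Longrightarrow> j \<le> N \<Longrightarrow> th i \<le> th j"
  shows "SST n (threshold_table N th)"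
proof -
  have "threshold_table N th i j \<le> threshold_table N th i k" if "j < k" "0 < j" for i j k
  proof (cases "k < i \<and> i \<le> N")
    case True
    \<comment> \<open>Both opponents are seeded above \<open>i\<close>; the one with the smaller
      threshold is at least as hard to beat.\<close>
    then have "th j \<le> th k" using that assms[of j k] by simp
    then show ?thesis using that True by (auto simp: threshold_table_def)
  next
    case False
    then show ?thesis using that by (auto simp: threshold_table_def)
  qed
  then show ?thesis
    by (auto simp: SST_def matchup_table_def threshold_table_def)
qed

text \<open>Four times \<open>threshold_table\<close> within the block, whose teams are numbered
  from 1 while \<open>ts\<close> is indexed from 0. A threshold beyond the block leaves a team even
  with all lower seeds of the block.\<close>

definition weight :: "nat list \<Rightarrow> nat \<Rightarrow> nat \<Rightarrow> int" where
  "weight ts i j =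
     (if i < j then if ts ! (i - 1) \<le> j then 3 else 2
      else if j < i then if ts ! (j - 1) \<le> i then 1 else 2
      else 2)"

definition counterexample :: "nat list \<Rightarrow> nat list \<Rightarrow> nat \<Rightarrow> bool" where
  "counterexample g ts a \<longleftrightarrow>
     fits g (length ts) \<and> sorted ts \<and> 0 < hd ts \<and> 0 < a \<and> a < length ts \<and>
     win (weight ts) g [1..<Suc (length ts)] a < win (weight ts) g [1..<Suc (length ts)] (Suc a)"

text \<open>The tables were found by computer search. Each game of the block is scaled by 4 to stay within
  the integers.\<close>

lemma counterexamples:
  "counterexample [6, 4, 2] [4, 4, 6, 8, 8, 8, 8] 6"
  "counterexample [8, 4, 2] [2, 4, 6, 8, 8, 8, 8, 9] 6"
  "counterexample [4, 4, 4, 2] [5, 5, 8, 9, 9, 9, 9, 9] 5"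
  "counterexample [6, 4, 4, 2] [4, 4, 9, 10, 10, 10, 10, 10, 10] 4"
  "counterexample [8, 4, 4, 2] [4, 4, 9, 11, 11, 11, 11, 11, 11, 11] 4"
  by code_simp+

lemma threshold_table_weight:
  assumes "x \<in> {1..length ts}" "y \<in> {1..length ts}"
  shows "4 * threshold_table (h + length ts) (\<lambda>i. if i \<le> h then Suc h else h + ts ! (i - h - 1)) (h + x) (h + y) =
    of_int (weight ts x y)"
  using assms by (auto simp: threshold_table_def weight_def)

text \<open>The teams above the block beat all teams of the block with probability \<open>3 / 4\<close>, so the winner of
  the block has the same chance in the later rounds whoever it is; the teams below the block lose all
  their games.\<close>

lemma unordered_block:
  assumes c: "counterexample g ts a" and fits: "fits (pre @ g @ suf) n"
  shows "\<exists>p i j. SST n p \<and> i \<in> {1..n} \<and> j \<in> {1..n} \<and> i < j \<and>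
    win p (pre @ g @ suf) [1..<Suc n] i < win p (pre @ g @ suf) [1..<Suc n] j"
proof -
  define k where "k = length ts"
  \<comment> \<open>Exactly the teams up to \<open>N\<close> are left after \<open>pre\<close>; the
    last \<open>k\<close> of them play the block and the first \<open>h\<close> wait above
    it.\<close>
  define N where "N = n - sum_list (map (\<lambda>m. m div 2) pre)"
  define h where "h = N - k"
  define th where "th = (\<lambda>i. if i \<le> h then Suc h else h + ts ! (i - h - 1))"
  define p where "p = threshold_table N th"
  have g: "fits g k" "sorted ts" "0 < hd ts" "0 < a" "a < k"
    and lt: "win (weight ts) g [1..<Suc k] a < win (weight ts) g [1..<Suc k] (Suc a)"
    using c by (auto simp: counterexample_def k_def)
  have chalk: "fits (g @ suf) N \<and> win p (pre @ (g @ suf)) [1..<Suc n] i = win p (g @ suf) [1..<Suc N] i" for i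
    by (rule win_chalk[OF _ fits N_def]) (auto simp: p_def threshold_table_def)
  then have fN: "k \<le> N" "fits suf (N - k + 1)" using fits_append g(1) by blast+
  have Nn: "N \<le> n" by (simp add: N_def)
  have N: "N = h + k" using fN by (simp add: h_def)
  have ts1: "1 \<le> ts ! m" if "m < k" for m
    using that g(2,3) sorted_nth_mono[of ts 0 m] by (cases ts) (auto simp: k_def)
  have sst: "SST n p" unfolding p_def
  proof (rule SST_threshold_table)
    fix i j assume ij: "0 < i" "i \<le> j" "j \<le> N"
    show "th i \<le> th j"
    proof (cases "h < i")
      case True
      then show ?thesis using ij N g(2) by (auto simp: th_def k_def intro: sorted_nth_mono)
    next
      case False
      then show ?thesis using ij N ts1[of "j - h - 1"] by (auto simp: th_def)
    qed
  qed
  have B: "[1..<Suc N] = [1..<Suc h] @ map ((+) h) [1..<Suc k]"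
  proof -
    have "map ((+) h) [1..<Suc k] = [Suc h..<Suc N]"
      by (rule nth_equalityI) (auto simp: N simp del: upt_Suc)
    then show ?thesis using upt_add_eq_append[of 1 "Suc h" k] by (simp add: N del: upt_Suc)
  qed
  have W: "4 ^ sum_list (map (\<lambda>m. m div 2) g) * win p (pre @ g @ suf) [1..<Suc n] (h + x) =
      of_int (win (weight ts) g [1..<Suc k] x) * (1 / 4) ^ length suf" if x: "x \<in> {1..k}" for x
  proof -
    have s: "sorted_wrt (<) [1..<Suc N]" by (simp add: sorted_wrt_upt del: upt_Suc)
    have "win p (g @ suf) [1..<Suc N] (h + x) =
        win p g (map ((+) h) [1..<Suc k]) (h + x) * win p suf ([1..<Suc h] @ [h + x]) (h + x)"
      unfolding B
      by (rule win_append_bottom[OF s[unfolded B]]) (use g(1) x in \<open>auto simp del: upt_Suc\<close>)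
    moreover have "4 ^ sum_list (map (\<lambda>m. m div 2) g) * win p g (map ((+) h) [1..<Suc k]) (h + x) =
        of_int (win (weight ts) g [1..<Suc k] x)"
    proof (rule win_rescale)
      show "inj_on ((+) h) {1..k}" by simp
      show "4 * p (h + x) (h + y) = of_int (weight ts x y)" if "x \<in> {1..k}" "y \<in> {1..k}" for x y
        using that threshold_table_weight[of x ts y h] by (simp add: p_def th_def N k_def)
    qed (use x g(1) in \<open>auto simp: sorted_wrt_upt simp del: upt_Suc\<close>)
    moreover have "win p suf ([1..<Suc h] @ [h + x]) (h + x) = (1 / 4) ^ length suf"
    proof (rule win_bottom)
      show "sorted_wrt (<) ([1..<Suc h] @ [h + x])"
        using x by (auto simp: sorted_wrt_append sorted_wrt_upt simp del: upt_Suc)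
      show "y < h + x \<and> p (h + x) y = 1 / 4" if "y \<in> set ([1..<Suc h] @ [h + x])" "y \<noteq> h + x" for y
        using that x N by (auto simp: p_def threshold_table_def th_def simp del: upt_Suc)
      show "p y z + p z y = 1" for y z
        by (auto simp: p_def threshold_table_def)
      show "fits suf (length ([1..<Suc h] @ [h + x]))" using fN by (simp add: h_def del: upt_Suc)
    qed simp
    ultimately show ?thesis using chalk by (simp add: mult.assoc[symmetric] del: upt_Suc)
  qed
  have "4 ^ sum_list (map (\<lambda>m. m div 2) g) * win p (pre @ g @ suf) [1..<Suc n] (h + a) <
      4 ^ sum_list (map (\<lambda>m. m div 2) g) * win p (pre @ g @ suf) [1..<Suc n] (h + Suc a)"
    using W[of a] W[of "Suc a"] g(4,5) lt by (simp del: upt_Suc)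
  then have "win p (pre @ g @ suf) [1..<Suc n] (h + a) < win p (pre @ g @ suf) [1..<Suc n] (h + Suc a)"
    by (simp del: upt_Suc)
  moreover have "h + a \<in> {1..n}" "h + Suc a \<in> {1..n}" "h + a < h + Suc a" using g(4,5) N Nn by auto
  ultimately show ?thesis using sst by blast
qed

subsection \<open>The blocks of two, four and six teams\<close>

declare win.simps(2) [simp del]

lemma win_two:
  assumes "a < b"
  shows "win p [2] [a, b] i = p a b * (if i = a then 1 else 0) + p b a * (if i = b then 1 else 0)"
  using assms by (auto simp: win.simps last_of_def pairing_def)

lemma win_four:
  assumes "a < b" "b < c" "c < d"
  shows "win p [4, 2] [a, b, c, d] i =
    p a d * (p b c * win p [2] [a, b] i + p c b * win p [2] [a, c] i) +
    p d a * (p b c * win p [2] [b, d] i + p c b * win p [2] [c, d] i)"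
  using assms unfolding win.simps(2)[of p 4]
  by (simp add: last_of_def pairing_def)

text \<open>Only the first round is unfolded, which leaves four-team tournaments to which the
  comparisons for four teams apply.\<close>

lemma win_six:
  assumes "a < b" "b < c" "c < d" "d < e" "e < f"
  shows "win p [4, 4, 2] [a, b, c, d, e, f] i =
    p c f * (p d e * win p [4, 2] [a, b, c, d] i + p e d * win p [4, 2] [a, b, c, e] i) +
    p f c * (p d e * win p [4, 2] [a, b, d, f] i + p e d * win p [4, 2] [a, b, e, f] i)"
  using assms unfolding win.simps(2)[of p 4 "[4, 2]"]
  by (simp add: last_of_def pairing_def)

lemma win_four_explicit:
  assumes "a < b" "b < c" "c < d"
  shows "win p [4, 2] [a, b, c, d] a = p a d * (p b c * p a b + p c b * p a c)"
    "win p [4, 2] [a, b, c, d] b = p b c * (p a d * p b a + p d a * p b d)"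
    "win p [4, 2] [a, b, c, d] c = p c b * (p a d * p c a + p d a * p c d)"
    "win p [4, 2] [a, b, c, d] d = p d a * (p b c * p d b + p c b * p d c)"
  using assms by (auto simp: win_four win_two algebra_simps)

text \<open>Used for the top two of four teams. After replacing \<open>v\<close> by \<open>y\<close>
  and \<open>w\<close> by \<open>x\<close>, the difference of the sides is
  \<open>x * y * (2 * u - 1) + x * y * (x - y)\<close>.\<close>

lemma four_step_1:
  fixes u v w x y :: real
  assumes "0 \<le> y" "y \<le> v" "w \<le> x" "y \<le> x" "x \<le> 1" "1 / 2 \<le> u"
  shows "y * (x * (1 - u) + (1 - x) * w) \<le> x * (y * u + (1 - y) * v)"
proof -
  have "x * (1 - y) * y \<le> x * (1 - y) * v" "y * (1 - x) * w \<le> y * (1 - x) * x"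
    using assms by (auto intro!: mult_left_mono)
  moreover have "0 \<le> x * y * (2 * u - 1)" "0 \<le> x * y * (x - y)" using assms by auto
  ultimately show ?thesis by (simp add: algebra_simps)
qed

text \<open>The same estimate for the lowest two of four teams: \<open>u\<close> is replaced by
  \<open>t\<close> and \<open>w\<close> by \<open>s\<close>.\<close>

lemma four_step_3:
  fixes s t u v w :: real
  assumes "0 \<le> t" "t \<le> u" "w \<le> s" "t \<le> s" "s \<le> 1" "1 / 2 \<le> v"
  shows "t * ((1 - s) * w + s * (1 - v)) \<le> s * ((1 - t) * u + t * v)"
proof -
  have "s * (1 - t) * t \<le> s * (1 - t) * u" "t * (1 - s) * w \<le> t * (1 - s) * s"
    using assms by (auto intro!: mult_left_mono)
  moreover have "0 \<le> s * t * (2 * v - 1)" "0 \<le> s * t * (s - t)" using assms by auto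
  ultimately show ?thesis by (simp add: algebra_simps)
qed

section \<open>Monotonicity of SST tables and the two-team block\<close>

locale sst =
  fixes n :: nat and p :: "nat \<Rightarrow> nat \<Rightarrow> real"
  assumes sst: "SST n p"
begin

lemma table: "matchup_table n p"
  using sst by (simp add: SST_def)

lemma bounds: "x \<in> {1..n} \<Longrightarrow> y \<in> {1..n} \<Longrightarrow> 0 \<le> p x y \<and> p x y \<le> 1"
  using table by (simp add: matchup_table_def)

lemma flip: "x \<in> {1..n} \<Longrightarrow> y \<in> {1..n} \<Longrightarrow> p y x = 1 - p x y"
  using table unfolding matchup_table_def by (metis add_diff_cancel_left')

lemma mono_right: "x \<in> {1..n} \<Longrightarrow> y \<in> {1..n} \<Longrightarrow> z \<in> {1..n} \<Longrightarrow> y \<le> z \<Longrightarrow> p x y \<le> p x z"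
  using sst by (cases "y = z") (auto simp: SST_def)

lemma mono_left: "x \<in> {1..n} \<Longrightarrow> y \<in> {1..n} \<Longrightarrow> z \<in> {1..n} \<Longrightarrow> x \<le> y \<Longrightarrow> p y z \<le> p x z"
  using mono_right[of z x y] flip[of x z] flip[of y z] by simp

lemma favourite:
  assumes "x \<in> {1..n}" "y \<in> {1..n}" "x < y" shows "1 / 2 \<le> p x y"
  using mono_right[of x x y] flip[of x x] assms by simp

lemma prob_order:
  assumes "x \<in> {1..n}" "y \<in> {1..n}" "u \<in> {1..n}" "v \<in> {1..n}" "x \<le> u" "v \<le> y"
  shows "p u v \<le> p x y"
  using mono_left[of x u v] mono_right[of x v y] assms by simp

lemma ordered_two: "ordered_block n p [2]"
  unfolding ordered_block_def
proof (intro conjI allI impI ballI; elim conjE)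
  fix xs i j assume xs: "sorted_wrt (<) xs" "set xs \<subseteq> {1..n}" "fits [2] (length xs)"
    and ij: "i \<in> set xs" "j \<in> set xs" "i < j"
  from xs(3) have "length xs = Suc (Suc 0)" by auto
  then obtain a b where ab: "xs = [a, b]" by (auto simp: length_Suc_conv)
  have "a < b" "i = a" "j = b" "a \<in> {1..n}" "b \<in> {1..n}" using xs ij ab by auto
  then show "win p [2] xs j \<le> win p [2] xs i"
    using favourite[of a b] flip[of a b] by (simp add: ab win_two)
next
  fix T x y assume T: "sorted_wrt (<) (T @ [x, y])" "set (T @ [x, y]) \<subseteq> {1..n}"
    "fits [2] (length T + 1)"
  from T(3) have "length T = Suc 0" by auto
  then obtain a where a: "T = [a]" by (auto simp: length_Suc_conv)
  show "win p [2] (T @ [y]) y \<le> win p [2] (T @ [x]) x"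
    using T mono_left[of x y a] by (simp add: a win_two)
qed

section \<open>The four-team block\<close>

context
  fixes a b c d :: nat
  assumes abcd: "a < b" "b < c" "c < d" "{a, b, c, d} \<subseteq> {1..n}"
begin

lemma four_ordered:
  "win p [4, 2] [a, b, c, d] b \<le> win p [4, 2] [a, b, c, d] a"
  "win p [4, 2] [a, b, c, d] c \<le> win p [4, 2] [a, b, c, d] b"
  "win p [4, 2] [a, b, c, d] d \<le> win p [4, 2] [a, b, c, d] c"
proof -
  have r: "a \<in> {1..n}" "b \<in> {1..n}" "c \<in> {1..n}" "d \<in> {1..n}" using abcd by auto
  note E = win_four_explicit[OF abcd(1-3)]
  show "win p [4, 2] [a, b, c, d] b \<le> win p [4, 2] [a, b, c, d] a"
    unfolding E flip[OF r(1,2)] flip[OF r(1,4)] flip[OF r(2,3)]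
    by (rule four_step_1) (use r abcd bounds prob_order favourite in auto)
  \<comment> \<open>Here \<open>b\<close> and \<open>c\<close> occupy symmetric positions, so SST
    compares the expressions factor by factor.\<close>
  show "win p [4, 2] [a, b, c, d] c \<le> win p [4, 2] [a, b, c, d] b"
    unfolding E using r abcd
    by (intro mult_mono add_mono mult_left_mono add_nonneg_nonneg mult_nonneg_nonneg prob_order)
      (use bounds favourite[of b c] flip[of b c] in auto)
  show "win p [4, 2] [a, b, c, d] d \<le> win p [4, 2] [a, b, c, d] c"
    unfolding E flip[OF r(4,1)] flip[OF r(3,2)] flip[OF r(3,4)]
    by (rule four_step_3) (use r abcd bounds prob_order favourite in auto)
qed

end

lemma four_last_mono:
  assumes "a < b" "b < c" "c < x" "x < y" "{a, b, c, x, y} \<subseteq> {1..n}"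
  shows "win p [4, 2] [a, b, c, y] y \<le> win p [4, 2] [a, b, c, x] x"
proof -
  have "a < b" "b < c" "c < x" "c < y" using assms by auto
  then show ?thesis
    unfolding win_four_explicit(4)[OF \<open>a < b\<close> \<open>b < c\<close> \<open>c < x\<close>] win_four_explicit(4)[OF \<open>a < b\<close> \<open>b < c\<close> \<open>c < y\<close>]
    using assms
    by (intro mult_mono add_mono mult_left_mono add_nonneg_nonneg mult_nonneg_nonneg prob_order)
      (use bounds in auto)
qed

text \<open>Needed in \<open>six_4\<close>, where either of two neighbours may be third of the four
  teams left, above the same lowest seed.\<close>

lemma four_third_mono:
  assumes "a < b" "b < x" "x < y" "y < d" "{a, b, d, x, y} \<subseteq> {1..n}"
  shows "win p [4, 2] [a, b, y, d] y \<le> win p [4, 2] [a, b, x, d] x"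
proof -
  have "a < b" "b < x" "x < d" "b < y" "y < d" using assms by auto
  then show ?thesis
    unfolding win_four_explicit(3)[OF \<open>a < b\<close> \<open>b < x\<close> \<open>x < d\<close>] win_four_explicit(3)[OF \<open>a < b\<close> \<open>b < y\<close> \<open>y < d\<close>]
    using assms
    by (intro mult_mono add_mono mult_left_mono add_nonneg_nonneg mult_nonneg_nonneg prob_order)
      (use bounds in auto)
qed

lemma ordered_four: "ordered_block n p [4, 2]"
  unfolding ordered_block_def
proof (intro conjI allI impI ballI; elim conjE)
  fix xs i j assume xs: "sorted_wrt (<) xs" "set xs \<subseteq> {1..n}" "fits [4, 2] (length xs)"
    and ij: "i \<in> set xs" "j \<in> set xs" "i < j"
  from xs(3) have "length xs = Suc (Suc (Suc (Suc 0)))" by auto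
  then obtain a b c d where ab: "xs = [a, b, c, d]" by (auto simp: length_Suc_conv)
  have "a < b" "b < c" "c < d" "{a, b, c, d} \<subseteq> {1..n}" using xs ab by auto
  note four_ordered[OF this]
  then show "win p [4, 2] xs j \<le> win p [4, 2] xs i"
    using xs(1) ij unfolding ab by auto
next
  fix T x y assume T: "sorted_wrt (<) (T @ [x, y])" "set (T @ [x, y]) \<subseteq> {1..n}"
    "fits [4, 2] (length T + 1)"
  from T(3) have "length T = Suc (Suc (Suc 0))" by auto
  then obtain a b c where a: "T = [a, b, c]" by (auto simp: length_Suc_conv)
  show "win p [4, 2] (T @ [y]) y \<le> win p [4, 2] (T @ [x]) x"
    using T four_last_mono[of a b c x y] by (simp add: a)
qed

section \<open>The six-team block\<close>

context
  fixes a b c d e f :: nat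
  assumes lt: "a < b" "b < c" "c < d" "d < e" "e < f" and sub: "{a, b, c, d, e, f} \<subseteq> {1..n}"
begin

lemma six_mem: "a \<in> {1..n}" "b \<in> {1..n}" "c \<in> {1..n}" "d \<in> {1..n}" "e \<in> {1..n}" "f \<in> {1..n}"
  using sub by auto

lemma six_less: "b < d" "b < e" "c < e" "d < f" "a < e" "a < f" "a < c" "a < d" "b < f" "c < f"
  using lt by auto

lemma four_nonneg:
  assumes "w < x" "x < y" "y < z" "{w, x, y, z} \<subseteq> {1..n}"
  shows "0 \<le> win p [4, 2] [w, x, y, z] i"
  by (rule win_nonneg[of "{1..n}"]) (use assms bounds in auto)

lemmas E6 = win_six[OF lt]

text \<open>Both teams have a bye in the first round, so every outcome leaves an instance of
  \<open>four_ordered\<close>.\<close>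

lemma six_1: "win p [4, 4, 2] [a, b, c, d, e, f] b \<le> win p [4, 4, 2] [a, b, c, d, e, f] a"
  unfolding E6 using lt six_less six_mem
  by (intro add_mono mult_left_mono four_ordered) (auto simp: bounds)

text \<open>Team \<open>b\<close> has a bye. If \<open>c\<close> loses its first game it contributes
  0, otherwise \<open>four_ordered\<close> applies.\<close>

lemma six_2: "win p [4, 4, 2] [a, b, c, d, e, f] c \<le> win p [4, 4, 2] [a, b, c, d, e, f] b"
proof -
  have z: "win p [4, 2] [a, b, d, f] c = 0" "win p [4, 2] [a, b, e, f] c = 0"
    using lt by (auto intro!: win_eq_0)
  show ?thesis unfolding E6 z using lt six_less six_mem
    by (intro add_mono mult_left_mono four_ordered)
      (auto simp: bounds four_nonneg)
qed

text \<open>If both teams win their first games, the four-team case applies. It remains to compare the two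
  outcomes of the first round that leave only one of them, with the same two games left to win.\<close>

lemma six_3: "win p [4, 4, 2] [a, b, c, d, e, f] d \<le> win p [4, 4, 2] [a, b, c, d, e, f] c"
proof -
  have z: "win p [4, 2] [a, b, c, e] d = 0" "win p [4, 2] [a, b, e, f] d = 0"
    "win p [4, 2] [a, b, d, f] c = 0" "win p [4, 2] [a, b, e, f] c = 0"
    using lt by (auto intro!: win_eq_0)
  have "p f c * p d e * (p d b * (p a f * p d a + p f a * p d f)) \<le>
      p c f * p e d * (p c b * (p a e * p c a + p e a * p c e))"
  proof -
    \<comment> \<open>As \<open>p a e\<close> is at most \<open>p a f\<close>, weight moves from
      \<open>p d a\<close> to the larger \<open>p d f\<close>, which does not lower the average;
      then \<open>p d a\<close> is raised to \<open>p c a\<close>.\<close>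
    have 1: "p a f * p d a + p f a * p d f \<le> p a e * p c a + p e a * p d f"
    proof -
      have "(p a f - p a e) * (p d f - p d a) \<ge> 0"
        using lt six_mem by (intro mult_nonneg_nonneg) (auto intro: prob_order)
      moreover have "p a e * p d a \<le> p a e * p c a"
        using lt six_mem bounds by (intro mult_left_mono prob_order) auto
      ultimately show ?thesis unfolding flip[OF six_mem(1,6)] flip[OF six_mem(1,5)] by (simp add: algebra_simps)
    qed
    have pos: "0 \<le> p x y" if "x \<in> {1..n}" "y \<in> {1..n}" for x y using bounds that by simp
    have 2: "p f c * p d e \<le> p c f * p e d"
    proof -
      have "p d e \<le> p c f" using lt six_mem by (intro prob_order) auto
      then show ?thesis unfolding flip[OF six_mem(3,6)] flip[OF six_mem(4,5)] by (simp add: algebra_simps)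
    qed
    \<comment> \<open>SST does not order \<open>p d f\<close> and \<open>p c e\<close>, since both
      the team and its opponent are weaker on the left; together with the first-round factors the
      comparison holds.\<close>
    have 3: "p f c * p d e * p d f \<le> p c f * p e d * p c e"
    proof -
      have "p f c * (p d e * p d f) \<le> p e d * (p c e * p c f)"
        using lt six_mem pos by (intro mult_mono prob_order mult_nonneg_nonneg) auto
      then show ?thesis by (simp add: algebra_simps)
    qed
    have "p f c * p d e * (p a f * p d a + p f a * p d f) \<le>
        p f c * p d e * (p a e * p c a + p e a * p d f)"
      using 1 six_mem pos by (intro mult_left_mono) auto
    also have "\<dots> = p f c * p d e * (p a e * p c a) + p e a * (p f c * p d e * p d f)"
      by (simp add: algebra_simps)
    also have "\<dots> \<le> p c f * p e d * (p a e * p c a) + p e a * (p c f * p e d * p c e)"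
      using 2 3 six_mem pos by (intro add_mono mult_right_mono mult_left_mono) auto
    also have "\<dots> = p c f * p e d * (p a e * p c a + p e a * p c e)"
      by (simp add: algebra_simps)
    finally have "p f c * p d e * (p a f * p d a + p f a * p d f) \<le>
        p c f * p e d * (p a e * p c a + p e a * p c e)" .
    note L = this
    have M: "p d b \<le> p c b" "0 \<le> p c b" using lt six_mem pos by (auto intro: prob_order)
    have N: "0 \<le> p f c * p d e * (p a f * p d a + p f a * p d f)"
      using six_mem pos by (intro mult_nonneg_nonneg add_nonneg_nonneg) auto
    have "p d b * (p f c * p d e * (p a f * p d a + p f a * p d f)) \<le>
        p c b * (p c f * p e d * (p a e * p c a + p e a * p c e))"
      by (rule mult_mono[OF M(1) L M(2) N])
    then show ?thesis by (simp add: algebra_simps)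
  qed
  moreover have "p c f * (p d e * win p [4, 2] [a, b, c, d] d) \<le> p c f * (p d e * win p [4, 2] [a, b, c, d] c)"
    using lt six_mem bounds by (intro mult_left_mono four_ordered) auto
  ultimately show ?thesis unfolding E6 z
    using lt six_less by (simp add: win_four_explicit algebra_simps)
qed

text \<open>These two teams meet in the first round, and either winner takes the same place: last of
  four if \<open>c\<close> wins its game, third if \<open>f\<close> does.\<close>

lemma six_4: "win p [4, 4, 2] [a, b, c, d, e, f] e \<le> win p [4, 4, 2] [a, b, c, d, e, f] d"
proof -
  have z: "win p [4, 2] [a, b, c, e] d = 0" "win p [4, 2] [a, b, e, f] d = 0"
    "win p [4, 2] [a, b, c, d] e = 0" "win p [4, 2] [a, b, d, f] e = 0"
    using lt by (auto intro!: win_eq_0)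
  have de: "p e d \<le> p d e" using lt six_mem by (intro prob_order) auto
  have "p e d * win p [4, 2] [a, b, c, e] e \<le> p d e * win p [4, 2] [a, b, c, d] d"
    using lt six_less six_mem de by (intro mult_mono four_last_mono four_nonneg) (auto simp: bounds)
  moreover have "p e d * win p [4, 2] [a, b, e, f] e \<le> p d e * win p [4, 2] [a, b, d, f] d"
    using lt six_less six_mem de by (intro mult_mono four_third_mono four_nonneg) (auto simp: bounds)
  ultimately show ?thesis unfolding E6 z using six_mem bounds
    by (auto intro!: add_mono mult_left_mono)
qed

text \<open>Parallel to \<open>six_3\<close>: if both win their first games,
  \<open>four_ordered\<close> applies, and the outcomes that leave only one of them are compared
  directly.\<close>

lemma six_5: "win p [4, 4, 2] [a, b, c, d, e, f] f \<le> win p [4, 4, 2] [a, b, c, d, e, f] e"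
proof -
  have z: "win p [4, 2] [a, b, c, d] f = 0" "win p [4, 2] [a, b, c, e] f = 0"
    "win p [4, 2] [a, b, c, d] e = 0" "win p [4, 2] [a, b, d, f] e = 0"
    using lt by (auto intro!: win_eq_0)
  have pos: "0 \<le> p x y" if "x \<in> {1..n}" "y \<in> {1..n}" for x y using bounds that by simp
  have "p f c * p d e * (p f a * (p b d * p f b + p d b * p f d)) \<le>
      p c f * p e d * (p e a * (p b c * p e b + p c b * p e c))"
  proof -
    \<comment> \<open>Again weight is moved, now from \<open>p f b\<close> to the larger
      \<open>p f d\<close>, since \<open>p b c\<close> is at most \<open>p b d\<close>.\<close>
    have 1: "p b d * p f b + p d b * p f d \<le> p b c * p e b + p c b * p f d"
    proof -
      have "(p b d - p b c) * (p f d - p f b) \<ge> 0"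
        using lt six_mem by (intro mult_nonneg_nonneg) (auto intro: prob_order)
      moreover have "p b c * p f b \<le> p b c * p e b"
        using lt six_mem bounds by (intro mult_left_mono prob_order) auto
      ultimately show ?thesis unfolding flip[OF six_mem(2,4)] flip[OF six_mem(2,3)] by (simp add: algebra_simps)
    qed
    have 2: "p f c * p d e \<le> p c f * p e d"
    proof -
      have "p d e \<le> p c f" using lt six_mem by (intro prob_order) auto
      then show ?thesis unfolding flip[OF six_mem(3,6)] flip[OF six_mem(4,5)] by (simp add: algebra_simps)
    qed
    have 3: "p f c * p d e * p f d \<le> p c f * p e d * p e c"
    proof -
      have "p f c * (p d e * p f d) \<le> p e c * (p c f * p e d)"
        using lt six_mem pos by (intro mult_mono prob_order mult_nonneg_nonneg) auto
      then show ?thesis by (simp add: algebra_simps)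
    qed
    have "p f c * p d e * (p b d * p f b + p d b * p f d) \<le>
        p f c * p d e * (p b c * p e b + p c b * p f d)"
      using 1 six_mem pos by (intro mult_left_mono) auto
    also have "\<dots> = p f c * p d e * (p b c * p e b) + p c b * (p f c * p d e * p f d)"
      by (simp add: algebra_simps)
    also have "\<dots> \<le> p c f * p e d * (p b c * p e b) + p c b * (p c f * p e d * p e c)"
      using 2 3 six_mem pos by (intro add_mono mult_right_mono mult_left_mono) auto
    also have "\<dots> = p c f * p e d * (p b c * p e b + p c b * p e c)"
      by (simp add: algebra_simps)
    finally have "p f c * p d e * (p b d * p f b + p d b * p f d) \<le>
        p c f * p e d * (p b c * p e b + p c b * p e c)" .
    note L = this
    have M: "p f a \<le> p e a" "0 \<le> p e a" using lt six_mem pos by (auto intro: prob_order)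
    have N: "0 \<le> p f c * p d e * (p b d * p f b + p d b * p f d)"
      using six_mem pos by (intro mult_nonneg_nonneg add_nonneg_nonneg) auto
    have "p f a * (p f c * p d e * (p b d * p f b + p d b * p f d)) \<le>
        p e a * (p c f * p e d * (p b c * p e b + p c b * p e c))"
      by (rule mult_mono[OF M(1) L M(2) N])
    then show ?thesis by (simp add: algebra_simps)
  qed
  moreover have "p f c * (p e d * win p [4, 2] [a, b, e, f] f) \<le> p f c * (p e d * win p [4, 2] [a, b, e, f] e)"
    using lt six_less six_mem bounds by (intro mult_left_mono four_ordered) auto
  ultimately show ?thesis unfolding E6 z
    using lt six_less by (simp add: win_four_explicit algebra_simps)
qed

end

lemma ordered_six: "ordered_block n p [4, 4, 2]"
  unfolding ordered_block_def
proof (intro conjI allI impI ballI; elim conjE)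
  fix xs i j assume xs: "sorted_wrt (<) xs" "set xs \<subseteq> {1..n}" "fits [4, 4, 2] (length xs)"
    and ij: "i \<in> set xs" "j \<in> set xs" "i < j"
  from xs(3) have "length xs = Suc (Suc (Suc (Suc (Suc (Suc 0)))))" by auto
  then obtain a b c d e f where ab: "xs = [a, b, c, d, e, f]" by (auto simp: length_Suc_conv)
  have "a < b" "b < c" "c < d" "d < e" "e < f" "{a, b, c, d, e, f} \<subseteq> {1..n}" using xs ab by auto
  note six_1[OF this] six_2[OF this] six_3[OF this] six_4[OF this] six_5[OF this]
  then show "win p [4, 4, 2] xs j \<le> win p [4, 4, 2] xs i"
    using xs(1) ij unfolding ab by auto
next
  fix T x y assume T: "sorted_wrt (<) (T @ [x, y])" "set (T @ [x, y]) \<subseteq> {1..n}"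
    "fits [4, 4, 2] (length T + 1)"
  from T(3) have "length T = Suc (Suc (Suc (Suc (Suc 0))))" by auto
  then obtain a b c d e where a: "T = [a, b, c, d, e]" by (auto simp: length_Suc_conv)
  have lt: "a < b" "b < c" "c < d" "d < e" "e < x" "x < y" "{a, b, c, d, e, x, y} \<subseteq> {1..n}"
    using T a by auto
  \<comment> \<open>The last team must beat \<open>c\<close> to stay in, and is then the lowest of
    the four teams left.\<close>
  have E: "win p [4, 4, 2] [a, b, c, d, e, z] z =
      p z c * (p d e * win p [4, 2] [a, b, d, z] z + p e d * win p [4, 2] [a, b, e, z] z)"
    if "e < z" for z
    using win_six[of a b c d e z p z] lt that win_eq_0[of z "[a, b, c, d]" p "[4, 2]"]
      win_eq_0[of z "[a, b, c, e]" p "[4, 2]"] by simp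
  have nn: "0 \<le> win p [4, 2] [a, b, u, z] z" if "u \<in> {d, e}" "z \<in> {x, y}" for u z
    by (rule win_nonneg[of "{1..n}"]) (use lt that bounds in auto)
  have m: "a \<in> {1..n}" "b \<in> {1..n}" "c \<in> {1..n}" "d \<in> {1..n}" "e \<in> {1..n}" "x \<in> {1..n}" "y \<in> {1..n}"
    using lt by auto
  have "win p [4, 2] [a, b, d, y] y \<le> win p [4, 2] [a, b, d, x] x"
    "win p [4, 2] [a, b, e, y] y \<le> win p [4, 2] [a, b, e, x] x"
    using lt by (intro four_last_mono; simp)+
  then have "p d e * win p [4, 2] [a, b, d, y] y + p e d * win p [4, 2] [a, b, e, y] y \<le>
      p d e * win p [4, 2] [a, b, d, x] x + p e d * win p [4, 2] [a, b, e, x] x"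
    using m bounds by (intro add_mono mult_left_mono) auto
  moreover have "0 \<le> p d e * win p [4, 2] [a, b, d, y] y + p e d * win p [4, 2] [a, b, e, y] y"
    using m bounds nn by (intro add_nonneg_nonneg mult_nonneg_nonneg) auto
  moreover have "p y c \<le> p x c" "0 \<le> p x c" using m lt bounds by (auto intro: prob_order)
  ultimately have "win p [4, 4, 2] [a, b, c, d, e, y] y \<le> win p [4, 4, 2] [a, b, c, d, e, x] x"
    unfolding E[OF \<open>e < x\<close>] E[OF order_less_trans[OF \<open>e < x\<close> \<open>x < y\<close>]]
    by (intro mult_mono)
  then show "win p [4, 4, 2] (T @ [y]) y \<le> win p [4, 4, 2] (T @ [x]) x" by (simp add: a)
qed

lemma good_sizes_ordered: "good_sizes ms \<Longrightarrow> ordered_block n p ms"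
proof (induction rule: good_sizes.induct)
  case 1
  show ?case by (auto simp: ordered_block_def length_Suc_conv)
next
  case (2 ms)
  have "fits [2] 2" by simp
  from ordered_block_append[OF table this ordered_two 2(2)] show ?case by simp
next
  case (3 ms)
  have "fits [4, 2] 4" by simp
  from ordered_block_append[OF table this ordered_four 3(2)] show ?case by simp
next
  case (4 ms)
  have "fits [4, 4, 2] 6" by simp
  from ordered_block_append[OF table this ordered_six 4(2)] show ?case by simp
qed

end

theorem theorem2p5p17:
  fixes n r :: nat and b :: "nat \<Rightarrow> nat"
  assumes "reseeded_bracket n r b"
  shows "ordered_format n (champion_prob n r b) \<longleftrightarrow>
           proper n r b \<and> generated (signature n r b)"
proof -
  interpret bracket n r b by unfold_locales (rule assms)
  have gen: "generated (signature n r b) \<longleftrightarrow> good_sizes sizes"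
    unfolding signature_sizes by (rule generated_sig_from[OF chained_sizes])
  show ?thesis
  proof
    assume ord: "ordered_format n (champion_prob n r b)"
    have anti: "b j \<le> b i" if ij: "i \<in> {1..n}" "j \<in> {1..n}" "i < j" for i j
    proof (rule ccontr)
      assume "\<not> b j \<le> b i"
      \<comment> \<open>Fair coins form an SST table, and fewer byes mean more games, so the higher
        seed \<open>i\<close> would win with strictly smaller probability.\<close>
      then have "r - b j < r - b i" using byes_le[OF ij(2)] by linarith
      then have "((1 :: real) / 2) ^ (r - b i) < (1 / 2) ^ (r - b j)"
        by (intro power_strict_decreasing) auto
      moreover have "SST n (\<lambda>_ _. 1 / 2)" by (simp add: SST_def matchup_table_def)
      ultimately show False
        using ord ij fair_coins[OF ij(1)] fair_coins[OF ij(2)] by (fastforce simp: ordered_format_def)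
    qed
    have "good_sizes sizes"
    proof (rule ccontr)
      assume "\<not> good_sizes sizes"
      then obtain pre g suf where s: "sizes = pre @ g @ suf"
        and "g \<in> {[6, 4, 2], [8, 4, 2], [4, 4, 4, 2], [6, 4, 4, 2], [8, 4, 4, 2]}"
        using bad_sizes_split[OF chained_sizes] by blast
      then obtain ts a where "counterexample g ts a" using counterexamples by blast
      from unordered_block[OF this fits_sizes[unfolded s]] obtain p i j where
        p: "SST n p" "i \<in> {1..n}" "j \<in> {1..n}" "i < j"
        "win p sizes [1..<Suc n] i < win p sizes [1..<Suc n] j"
        unfolding s by blast
      have "matchup_table n p" using p(1) by (simp add: SST_def)
      from champion_prob_win[OF anti this] have "champion_prob n r b p i < champion_prob n r b p j"
        using p(5) by simp
      then show False using ord p(1-4) by (fastforce simp: ordered_format_def)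
    qed
    then show "proper n r b \<and> generated (signature n r b)" using anti proper_iff gen by blast
  next
    assume "proper n r b \<and> generated (signature n r b)"
    then have anti: "\<And>i j. i \<in> {1..n} \<Longrightarrow> j \<in> {1..n} \<Longrightarrow> i < j \<Longrightarrow> b j \<le> b i"
      and good: "good_sizes sizes" using proper_iff gen by auto
    show "ordered_format n (champion_prob n r b)" unfolding ordered_format_def
    proof (intro allI impI ballI)
      fix p i j assume p: "SST n p" and ij: "i \<in> {1..n}" "j \<in> {1..n}" "i < j"
      interpret sst n p by unfold_locales (rule p)
      have "win p sizes [1..<Suc n] j \<le> win p sizes [1..<Suc n] i"
        by (rule ordered_blockD1[OF good_sizes_ordered[OF good]])
          (use ij fits_sizes in \<open>auto simp: sorted_wrt_upt simp del: upt_Suc\<close>)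
      then show "champion_prob n r b p j \<le> champion_prob n r b p i"
        using champion_prob_win[OF anti table] by simp
    qed
  qed
qed

end
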